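(* Let $V$ be a separable infinite-dimensional right quaternionic Hilbert space and let $T\in\mathcal{B}(V)$. Then $$\partial\sigma_W^S(T)\subset\sigma_{1,W}^S(T).$$ In particular, if $\Phi_T$ is connected, then $$\partial\sigma_e^S(T)=\partial\sigma_W^S(T)\subset\{q\in\mathbb{H}:\ Q_q(T)\notin\Phi_l(V)\}.$$ Here $\partial$ denotes the topological boundary in $\mathbb{H}$.
   Context: $\mathbb{H}$ is the skew field of quaternions. A right quaternionic Hilbert space $V$ is a right $\mathbb{H}$-vector space with an $\mathbb{H}$-valued inner product satisfying $\langle f,gq+h\rangle=\langle f,g\rangle q+\langle f,h\rangle$, $\langle f,g\rangle=\overline{\langle g,f\rangle}$, $\langle f,f\rangle\ge 0$ with equality only for $f=0$, and complete for $\|f\|=\sqrt{\langle f,f\rangle}$. $\mathcal{B}(V)$ is the set of bounded right $\mathbb{H}$-linear operators on $V$, $\mathcal{K}(V)$ the closed two-sided ideal of compact ones; $N(\cdot)$ and $R(\cdot)$ denote null space and range. For $T\in\mathcal{B}(V)$ and $q\in\mathbb{H}$, $Q_q(T):=T^2-2\operatorname{Re}(q)T+|q|^2\mathbb{I}_V$. The $S$-spectrum $\sigma_S(T)$ is the set of $q\in\mathbb{H}$ such that $Q_q(T)$ is not invertible in $\mathcal{B}(V)$. The essential $S$-spectrum $\sigma_e^S(T)$ is the set of $q$ such that the class of $Q_q(T)$ is not invertible in the Calkin algebra $\mathcal{B}(V)/\mathcal{K}(V)$. The Weyl $S$-spectrum is $\sigma_W^S(T)=\bigcap_{K\in\mathcal{K}(V)}\sigma_S(T+K)$.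 $\Phi(V)$ is the set of Fredholm operators: $T\in\mathcal{B}(V)$ with $N(T)$ and $V/R(T)$ finite-dimensional. $\Phi_l(V)$ is the set of $T\in\mathcal{B}(V)$ with $R(T)$ closed and $\dim N(T)<\infty$. For $T\in\Phi_l(V)$ the index is $i(T)=\dim N(T)-\dim(V/R(T))$ (possibly $-\infty$). Put $\Phi_T:=\{q\in\mathbb{H}: Q_q(T)\in\Phi(V)\}$ and $$\sigma_{1,W}^S(T):=\mathbb{H}\setminus\{q\in\mathbb{H}:\ Q_q(T)\in\Phi_l(V)\text{ and } i(Q_q(T))\le 0\}.$$ Known facts: $\sigma_e^S(T)=\mathbb{H}\setminus\Phi_T$ and $\sigma_W^S(T)=\mathbb{H}\setminus\{q: Q_q(T)\in\Phi(V),\ i(Q_q(T))=0\}$. *)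

theory Defs
  imports "HOL-Analysis.Analysis" "HOL-Algebra.QuotRing"
begin

section \<open>The skew field of quaternions\<close>

codatatype quat = Quat (qRe: real) (qI: real) (qJ: real) (qK: real)

lemma quat_eq_iff: "x = y \<longleftrightarrow> qRe x = qRe y \<and> qI x = qI y \<and> qJ x = qJ y \<and> qK x = qK y"
  by (auto intro: quat.expand)

instantiation quat :: ab_group_add
begin

primcorec zero_quat where
  "qRe 0 = 0" | "qI 0 = 0" | "qJ 0 = 0" | "qK 0 = 0"

primcorec plus_quat where
  "qRe (x + y) = qRe x + qRe y"
| "qI (x + y) = qI x + qI y"
| "qJ (x + y) = qJ x + qJ y"
| "qK (x + y) = qK x + qK y"

primcorec uminus_quat where
  "qRe (- x) = - qRe x"
| "qI (- x) = - qI x"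
| "qJ (- x) = - qJ x"
| "qK (- x) = - qK x"

primcorec minus_quat where
  "qRe (x - y) = qRe x - qRe y"
| "qI (x - y) = qI x - qI y"
| "qJ (x - y) = qJ x - qJ y"
| "qK (x - y) = qK x - qK y"

instance
  by standard (simp_all add: quat_eq_iff)

end

instantiation quat :: ring_1
begin

primcorec one_quat where
  "qRe 1 = 1" | "qI 1 = 0" | "qJ 1 = 0" | "qK 1 = 0"

primcorec times_quat where
  "qRe (x * y) = qRe x * qRe y - qI x * qI y - qJ x * qJ y - qK x * qK y"
| "qI (x * y) = qRe x * qI y + qI x * qRe y + qJ x * qK y - qK x * qJ y"
| "qJ (x * y) = qRe x * qJ y - qI x * qK y + qJ x * qRe y + qK x * qI y"
| "qK (x * y) = qRe x * qK y + qI x * qJ y - qJ x * qI y + qK x * qRe y"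

instance
  by standard (simp_all add: quat_eq_iff algebra_simps)

end

primcorec qcnj :: "quat \<Rightarrow> quat" where
  "qRe (qcnj x) = qRe x"
| "qI (qcnj x) = - qI x"
| "qJ (qcnj x) = - qJ x"
| "qK (qcnj x) = - qK x"

instantiation quat :: real_algebra_1
begin

primcorec scaleR_quat where
  "qRe (scaleR r x) = r * qRe x"
| "qI (scaleR r x) = r * qI x"
| "qJ (scaleR r x) = r * qJ x"
| "qK (scaleR r x) = r * qK x"

instance
  by standard (simp_all add: quat_eq_iff algebra_simps)

end

instantiation quat :: real_inner
begin

definition inner_quat :: "quat \<Rightarrow> quat \<Rightarrow> real" where
  "inner_quat x y = qRe x * qRe y + qI x * qI y + qJ x * qJ y + qK x * qK y"

definition norm_quat :: "quat \<Rightarrow> real" where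
  "norm_quat x = sqrt ((qRe x)\<^sup>2 + (qI x)\<^sup>2 + (qJ x)\<^sup>2 + (qK x)\<^sup>2)"

definition sgn_quat :: "quat \<Rightarrow> quat" where
  "sgn_quat x = x /\<^sub>R norm x"

definition dist_quat :: "quat \<Rightarrow> quat \<Rightarrow> real" where
  "dist_quat x y = norm (x - y)"

definition uniformity_quat :: "(quat \<times> quat) filter" where
  "uniformity_quat = (INF e\<in>{0 <..}. principal {(x, y). dist x y < e})"

definition open_quat :: "quat set \<Rightarrow> bool" where
  "open_quat U \<longleftrightarrow> (\<forall>x\<in>U. eventually (\<lambda>(x', y). x' = x \<longrightarrow> y \<in> U) uniformity)"

instance
proof
  fix x y z :: quat and r :: real and U :: "quat set"
  show "sgn x = x /\<^sub>R norm x" by (rule sgn_quat_def)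
  show "dist x y = norm (x - y)" by (rule dist_quat_def)
  show "(uniformity :: (quat \<times> quat) filter) = (INF e\<in>{0 <..}. principal {(x, y). dist x y < e})"
    by (rule uniformity_quat_def)
  show "open U \<longleftrightarrow> (\<forall>x\<in>U. eventually (\<lambda>(x', y). x' = x \<longrightarrow> y \<in> U) uniformity)"
    by (rule open_quat_def)
  show "inner x y = inner y x" "inner (x + y) z = inner x z + inner y z"
    "inner (r *\<^sub>R x) y = r * inner x y"
    by (simp_all add: inner_quat_def algebra_simps)
  show "0 \<le> inner x x"
    by (simp add: inner_quat_def)
  show "inner x x = 0 \<longleftrightarrow> x = 0"
    by (simp add: inner_quat_def quat_eq_iff add_nonneg_eq_0_iff)
  show "norm x = sqrt (inner x x)"
    by (simp add: inner_quat_def norm_quat_def power2_eq_square)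
qed

end

instantiation quat :: real_normed_div_algebra
begin

definition inverse_quat :: "quat \<Rightarrow> quat" where
  "inverse_quat x = qcnj x /\<^sub>R (norm x)\<^sup>2"

definition divide_quat :: "quat \<Rightarrow> quat \<Rightarrow> quat" where
  "divide_quat x y = x * inverse y"

instance
proof
  fix x y :: quat
  have nsq: "(norm z)\<^sup>2 = qRe z * qRe z + qI z * qI z + qJ z * qJ z + qK z * qK z" for z :: quat
    by (simp add: norm_quat_def power2_eq_square)
  have cnj: "qcnj x * x = (norm x)\<^sup>2 *\<^sub>R 1" "x * qcnj x = (norm x)\<^sup>2 *\<^sub>R 1"
    unfolding nsq by (simp_all add: quat_eq_iff algebra_simps)
  have "qcnj x /\<^sub>R (norm x)\<^sup>2 * x = inverse ((norm x)\<^sup>2) *\<^sub>R (qcnj x * x)"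
    by (simp add: quat_eq_iff algebra_simps)
  moreover have "x * (qcnj x /\<^sub>R (norm x)\<^sup>2) = inverse ((norm x)\<^sup>2) *\<^sub>R (x * qcnj x)"
    by (simp add: quat_eq_iff algebra_simps)
  ultimately show "x \<noteq> 0 \<Longrightarrow> inverse x * x = 1" "x \<noteq> 0 \<Longrightarrow> x * inverse x = 1"
    by (simp_all add: inverse_quat_def cnj)
  show "x div y = x * inverse y" by (rule divide_quat_def)
  show "inverse (0::quat) = 0" by (simp add: inverse_quat_def quat_eq_iff)
  have "(norm (x * y))\<^sup>2 = (norm x * norm y)\<^sup>2"
    unfolding power_mult_distrib nsq by (simp add: algebra_simps)
  then show "norm (x * y) = norm x * norm y"
    by (simp add: power2_eq_iff_nonneg)
qed

end

section \<open>Right quaternionic Hilbert spaces\<close>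

class rquat_vector = ab_group_add +
  fixes scaleQ :: "'a \<Rightarrow> quat \<Rightarrow> 'a"  (infixl "*\<^sub>Q" 75)
  assumes scaleQ_add_left: "(x + y) *\<^sub>Q p = x *\<^sub>Q p + y *\<^sub>Q p"
    and scaleQ_add_right: "x *\<^sub>Q (p + q) = x *\<^sub>Q p + x *\<^sub>Q q"
    and scaleQ_scaleQ: "x *\<^sub>Q p *\<^sub>Q q = x *\<^sub>Q (p * q)"
    and scaleQ_one: "x *\<^sub>Q 1 = x"

text \<open>
  The real Banach space structure is determined by the quaternionic one, through
  \<open>scaleR_scaleQ\<close> and \<open>norm_eq_sqrt_qinner\<close>; having it as a superclass makes the
  metric, completeness and bounded linear maps of the library available.
\<close>

class rquat_hilbert = rquat_vector + banach +
  fixes qinner :: "'a \<Rightarrow> 'a \<Rightarrow> quat"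
  assumes scaleR_scaleQ: "r *\<^sub>R x = x *\<^sub>Q of_real r"
    and qinner_right_linear: "qinner f (g *\<^sub>Q q + h) = qinner f g * q + qinner f h"
    and qinner_cnj: "qinner f g = qcnj (qinner g f)"
    and qinner_nonneg: "qinner f f \<in> \<real>" "0 \<le> qRe (qinner f f)"
    and qinner_definite: "qinner f f = 0 \<Longrightarrow> f = 0"
    and norm_eq_sqrt_qinner: "norm f = sqrt (qRe (qinner f f))"

section \<open>Dimension\<close>

text \<open>
  For right subspaces \<open>W \<subseteq> U\<close>, \<open>qbasis_mod U W B\<close> says that the cosets \<open>b + W\<close>, \<open>b \<in> B\<close>,
  are pairwise distinct and form a finite basis of the quotient space \<open>U / W\<close>. All finite bases
  have the same number of elements, and the infimum over the empty set is \<open>\<infinity>\<close>.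
\<close>

definition qbasis_mod :: "'v::rquat_vector set \<Rightarrow> 'v set \<Rightarrow> 'v set \<Rightarrow> bool" where
  "qbasis_mod U W B \<longleftrightarrow> finite B \<and> B \<subseteq> U \<and>
     (\<forall>c. (\<Sum>b\<in>B. b *\<^sub>Q c b) \<in> W \<longrightarrow> (\<forall>b\<in>B. c b = 0)) \<and>
     (\<forall>u\<in>U. \<exists>c. u - (\<Sum>b\<in>B. b *\<^sub>Q c b) \<in> W)"

definition qdim_quot :: "'v::rquat_vector set \<Rightarrow> 'v set \<Rightarrow> enat" where
  "qdim_quot U W = (INF B\<in>{B. qbasis_mod U W B}. enat (card B))"

definition qdim :: "'v::rquat_vector set \<Rightarrow> enat" where
  "qdim U = qdim_quot U {0}"

section \<open>Operators\<close>

definition bounded_qops :: "('v::rquat_hilbert \<Rightarrow> 'v) set" where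
  "bounded_qops = {T. bounded_linear T \<and> (\<forall>x q. T (x *\<^sub>Q q) = T x *\<^sub>Q q)}"

definition compact_qops :: "('v::rquat_hilbert \<Rightarrow> 'v) set" where
  "compact_qops = {K \<in> bounded_qops. \<forall>S. bounded S \<longrightarrow> compact (closure (K ` S))}"

definition qop_ring :: "('v::rquat_hilbert \<Rightarrow> 'v) ring" where
  "qop_ring = \<lparr>carrier = bounded_qops, mult = (\<circ>), one = id,
     zero = (\<lambda>x. 0), add = (\<lambda>S T x. S x + T x)\<rparr>"

definition calkin :: "('v::rquat_hilbert \<Rightarrow> 'v) set ring" where
  "calkin = qop_ring Quot compact_qops"

definition null_space :: "('v::rquat_hilbert \<Rightarrow> 'v) \<Rightarrow> 'v set" where
  "null_space T = {x. T x = 0}"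

definition fredholm :: "('v::rquat_hilbert \<Rightarrow> 'v) set" where
  "fredholm = {T \<in> bounded_qops. qdim (null_space T) < \<infinity> \<and> qdim_quot UNIV (range T) < \<infinity>}"

definition left_fredholm :: "('v::rquat_hilbert \<Rightarrow> 'v) set" where
  "left_fredholm = {T \<in> bounded_qops. closed (range T) \<and> qdim (null_space T) < \<infinity>}"

text \<open>Meaningful only for a finite-dimensional null space; may take the value \<open>-\<infinity>\<close>.\<close>

definition fredholm_index :: "('v::rquat_hilbert \<Rightarrow> 'v) \<Rightarrow> ereal" where
  "fredholm_index T = ereal_of_enat (qdim (null_space T)) - ereal_of_enat (qdim_quot UNIV (range T))"

section \<open>S-spectra\<close>

definition Q_op :: "quat \<Rightarrow> ('v::rquat_hilbert \<Rightarrow> 'v) \<Rightarrow> 'v \<Rightarrow> 'v" where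
  "Q_op q T = (\<lambda>x. T (T x) - (2 * qRe q) *\<^sub>R T x + (norm q)\<^sup>2 *\<^sub>R x)"

definition S_spectrum :: "('v::rquat_hilbert \<Rightarrow> 'v) \<Rightarrow> quat set" where
  "S_spectrum T = {q. Q_op q T \<notin> Units qop_ring}"

definition ess_S_spectrum :: "('v::rquat_hilbert \<Rightarrow> 'v) \<Rightarrow> quat set" where
  "ess_S_spectrum T = {q. compact_qops +>\<^bsub>qop_ring\<^esub> Q_op q T \<notin> Units calkin}"

definition weyl_S_spectrum :: "('v::rquat_hilbert \<Rightarrow> 'v) \<Rightarrow> quat set" where
  "weyl_S_spectrum T = (\<Inter>K\<in>compact_qops. S_spectrum (\<lambda>x. T x + K x))"

definition fredholm_domain :: "('v::rquat_hilbert \<Rightarrow> 'v) \<Rightarrow> quat set" where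
  "fredholm_domain T = {q. Q_op q T \<in> fredholm}"

definition weyl1_S_spectrum :: "('v::rquat_hilbert \<Rightarrow> 'v) \<Rightarrow> quat set" where
  "weyl1_S_spectrum T = - {q. Q_op q T \<in> left_fredholm \<and> fredholm_index (Q_op q T) \<le> 0}"

end

theory Submission
  imports Defs
begin

text \<open>
  Call an operator Weyl if it is bijective plus compact; these are the Fredholm operators of index
  zero, but no index theory is needed. Weyl operators form an open set, and an operator that is
  injective and Weyl is bijective. If \<open>A\<close> is left Fredholm of index at most zero, a finite-rank
  perturbation makes it bounded below; if \<open>A\<close> is also a limit of Weyl operators, the perturbed
  approximants are uniformly bounded below, hence bijective, so \<open>A\<close> is Weyl. A Fredholm limit of Weyl
  operators is Weyl as well, so for connected \<open>fredholm_domain T\<close> the open set of all \<open>q\<close> with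
  \<open>Q_op q T\<close> Weyl, which contains all large real numbers, is the whole domain.

  It remains to see that the Weyl spectrum is the complement of this set: if \<open>Q_op q T\<close> is Weyl, some
  compact \<open>K\<close> makes \<open>Q_op q (T + K)\<close> bijective. Since the perturbation enters quadratically, one
  works with the complex-linear factor \<open>x \<mapsto> T x - x l\<close>, where \<open>l\<close> is a complex number with the
  real part and norm of \<open>q\<close>, and lowers the dimension of its null space by rank-one perturbations.
\<close>

text \<open>In the Weyl spectrum the compact operator is added to \<open>T\<close>, so only
  perturbations of \<open>Q_op q T\<close> of the special form produced by
  \<open>Q_op q (T + K)\<close> are available, and being bijective plus compact does not exhibit a
  bijective one among them. A linear factor depends on \<open>T\<close> additively, but it commutes
  only with right multiplication by complex scalars, whereas \<open>K\<close> has to remain right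
  quaternionic linear. The range of a rank-one \<open>K\<close> is thus two-dimensional over the
  complex numbers and may meet the range of the factor in a complex line; this case dictates the
  coefficient of \<open>K\<close>. Right multiplication by j exchanges the two factors, so
  controlling the null space of one of them is enough.

  The index enters through its sign: index at most zero provides at least as many independent
  directions outside the range as there are in the null space. In the connected case, a boundary
  point with left Fredholm \<open>Q_op q T\<close> would have positive index by the first inclusion;
  this forces finite codimension and puts the point into \<open>fredholm_domain T\<close>, which
  contains no boundary point.\<close>

lemma norm_quat_square: "(norm x)\<^sup>2 = (qRe x)\<^sup>2 + (qI x)\<^sup>2 + (qJ x)\<^sup>2 + (qK x)\<^sup>2"
  by (simp add: norm_quat_def)

lemma of_real_quat_sel [simp]:
  "qRe (of_real r) = r" "qI (of_real r) = 0" "qJ (of_real r) = 0" "qK (of_real r) = 0"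
  by (simp_all add: of_real_def)

lemma qcnj_mult: "qcnj (x * y) = qcnj y * qcnj x"
  by (simp add: quat_eq_iff algebra_simps)

lemma qcnj_add: "qcnj (x + y) = qcnj x + qcnj y"
  by (simp add: quat_eq_iff)

lemma qcnj_of_real [simp]: "qcnj (of_real r) = of_real r"
  by (simp add: quat_eq_iff)

lemma of_real_quat_commute: "of_real r * (q::quat) = q * of_real r"
  by (simp add: quat_eq_iff mult.commute)

lemma qcnj_0 [simp]: "qcnj 0 = 0" and qcnj_1 [simp]: "qcnj 1 = 1"
  by (simp_all add: quat_eq_iff)

lemma qcnj_mult_self: "qcnj q * q = of_real ((norm q)\<^sup>2)" "q * qcnj q = of_real ((norm q)\<^sup>2)"
  unfolding norm_quat_square by (simp_all add: quat_eq_iff power2_eq_square)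

lemma norm_qcnj [simp]: "norm (qcnj q) = norm q"
  by (simp add: norm_quat_def)

lemma qRe_le_norm: "\<bar>qRe q\<bar> \<le> norm q"
proof -
  have "(qRe q)\<^sup>2 \<le> (norm q)\<^sup>2"
    unfolding norm_quat_square by simp
  then show ?thesis
    by (simp add: abs_le_square_iff[symmetric])
qed

text \<open>In coordinates the ball is a closed subset of a continuous image of a compact box in
  real 4-space. Compactness of rank-one operators rests on it.\<close>

lemma compact_quat_cball: "compact (cball (0::quat) r)"
proof -
  define f where "f = (\<lambda>(a, b, c, d). a *\<^sub>R (1::quat) + b *\<^sub>R Quat 0 1 0 0 + c *\<^sub>R Quat 0 0 1 0 + d *\<^sub>R Quat 0 0 0 1)"
  let ?S = "cbox (- r, - r, - r, - r) (r, r, r, r)"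
  have f: "f (a, b, c, d) = Quat a b c d" for a b c d
    by (simp add: f_def quat_eq_iff)
  have "cball (0::quat) r \<subseteq> f ` ?S"
  proof
    fix q :: quat
    assume "q \<in> cball 0 r"
    then have q: "norm q \<le> r" by simp
    have "(qRe q)\<^sup>2 \<le> (norm q)\<^sup>2" "(qI q)\<^sup>2 \<le> (norm q)\<^sup>2" "(qJ q)\<^sup>2 \<le> (norm q)\<^sup>2" "(qK q)\<^sup>2 \<le> (norm q)\<^sup>2"
      unfolding norm_quat_square by simp_all
    then have "\<bar>qRe q\<bar> \<le> norm q" "\<bar>qI q\<bar> \<le> norm q" "\<bar>qJ q\<bar> \<le> norm q" "\<bar>qK q\<bar> \<le> norm q"
      unfolding abs_le_square_iff[symmetric] abs_norm_cancel by blast+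
    then have "qRe q \<in> {- r..r}" "qI q \<in> {- r..r}" "qJ q \<in> {- r..r}" "qK q \<in> {- r..r}"
      using q by auto
    then have "(qRe q, qI q, qJ q, qK q) \<in> ?S"
      by (simp add: cbox_Pair_eq)
    moreover have "q = f (qRe q, qI q, qJ q, qK q)"
      unfolding f by (simp add: quat_eq_iff)
    ultimately show "q \<in> f ` ?S" by blast
  qed
  moreover have "compact (f ` ?S)"
    unfolding f_def case_prod_beta by (intro compact_continuous_image compact_cbox continuous_intros)
  moreover have "cball (0::quat) r = f ` ?S \<inter> cball 0 r"
    using calculation(1) by blast
  ultimately show ?thesis
    by (metis closed_cball compact_Int_closed)
qed

section \<open>Quaternionic inner products\<close>

lemma scaleQ_zero_left [simp]: "0 *\<^sub>Q q = (0::'a::rquat_vector)"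
  using scaleQ_add_left[of 0 0 q] by simp

lemma scaleQ_zero_right [simp]: "x *\<^sub>Q 0 = (0::'a::rquat_vector)"
  using scaleQ_add_right[of x 0 0] by simp

lemma scaleQ_minus_left [simp]: "(- x) *\<^sub>Q q = - (x *\<^sub>Q q :: 'a::rquat_vector)"
  using scaleQ_add_left[of x "- x" q] by (simp add: add_eq_0_iff)

lemma scaleQ_minus_right [simp]: "x *\<^sub>Q (- q) = - (x *\<^sub>Q q :: 'a::rquat_vector)"
  using scaleQ_add_right[of x q "- q"] by (simp add: add_eq_0_iff)

lemma scaleQ_diff_left: "(x - y) *\<^sub>Q q = x *\<^sub>Q q - (y *\<^sub>Q q :: 'a::rquat_vector)"
  using scaleQ_add_left[of x "- y" q] by simp

lemma scaleQ_diff_right: "x *\<^sub>Q (p - q) = x *\<^sub>Q p - (x *\<^sub>Q q :: 'a::rquat_vector)"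
  using scaleQ_add_right[of x p "- q"] by simp

lemma scaleQ_sum_left: "(\<Sum>i\<in>I. f i) *\<^sub>Q q = (\<Sum>i\<in>I. (f i *\<^sub>Q q :: 'a::rquat_vector))"
  by (induction I rule: infinite_finite_induct) (simp_all add: scaleQ_add_left)

lemma scaleR_scaleQ_commute: "(r *\<^sub>R x) *\<^sub>Q q = r *\<^sub>R (x *\<^sub>Q q :: 'a::rquat_hilbert)"
proof -
  have "of_real r * q = q * of_real r" by (simp add: quat_eq_iff)
  then show ?thesis by (simp add: scaleR_scaleQ scaleQ_scaleQ)
qed

lemma qinner_zero_right [simp]: "qinner f (0::'a::rquat_hilbert) = 0"
  using qinner_right_linear[of f 0 1 0] by (simp add: scaleQ_one)

lemma qinner_add_right: "qinner f (g + h :: 'a::rquat_hilbert) = qinner f g + qinner f h"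
  using qinner_right_linear[of f g 1 h] by (simp add: scaleQ_one)

lemma qinner_scaleQ_right: "qinner f (g *\<^sub>Q q :: 'a::rquat_hilbert) = qinner f g * q"
  using qinner_right_linear[of f g q 0] by simp

lemma qinner_zero_left [simp]: "qinner (0::'a::rquat_hilbert) f = 0"
  by (subst qinner_cnj) simp

lemma qinner_add_left: "qinner (g + h :: 'a::rquat_hilbert) f = qinner g f + qinner h f"
  by (metis qinner_cnj qinner_add_right qcnj_add)

lemma qinner_scaleQ_left: "qinner (g *\<^sub>Q q :: 'a::rquat_hilbert) f = qcnj q * qinner g f"
  by (metis qinner_cnj qinner_scaleQ_right qcnj_mult)

lemma qinner_diff_right: "qinner f (g - h :: 'a::rquat_hilbert) = qinner f g - qinner f h"
  using qinner_add_right[of f "g - h" h] by simp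

lemma qinner_sum_right: "qinner f (\<Sum>i\<in>I. g i :: 'a::rquat_hilbert) = (\<Sum>i\<in>I. qinner f (g i))"
  by (induction I rule: infinite_finite_induct) (simp_all add: qinner_add_right)

lemma qinner_self: "qinner f f = of_real ((norm (f::'a::rquat_hilbert))\<^sup>2)"
proof -
  obtain r where "qinner f f = of_real r"
    using qinner_nonneg(1)[of f] by (auto elim: Reals_cases)
  with qinner_nonneg(2)[of f] show ?thesis
    by (simp add: norm_eq_sqrt_qinner)
qed

lemma norm_scaleQ: "norm (x *\<^sub>Q q) = norm (x::'a::rquat_hilbert) * norm q"
proof -
  have "qinner (x *\<^sub>Q q) (x *\<^sub>Q q) = qcnj q * (of_real ((norm x)\<^sup>2) * q)"
    unfolding qinner_scaleQ_left qinner_scaleQ_right by (simp only: qinner_self mult.assoc)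
  also have "\<dots> = of_real ((norm x * norm q)\<^sup>2)"
    unfolding of_real_quat_commute[of "(norm x)\<^sup>2" q] mult.assoc[symmetric] qcnj_mult_self
    by (simp only: power_mult_distrib of_real_mult[symmetric] mult.commute)
  finally have "qinner (x *\<^sub>Q q) (x *\<^sub>Q q) = of_real ((norm x * norm q)\<^sup>2)" .
  then have "of_real ((norm (x *\<^sub>Q q))\<^sup>2) = (of_real ((norm x * norm q)\<^sup>2) :: quat)"
    by (simp only: qinner_self)
  then have "(norm (x *\<^sub>Q q))\<^sup>2 = (norm x * norm q)\<^sup>2"
    by (simp only: of_real_eq_iff)
  then show ?thesis
    by (simp add: power2_eq_iff_nonneg)
qed

lemma norm_add_square:
  "(norm (f + g :: 'a::rquat_hilbert))\<^sup>2 = (norm f)\<^sup>2 + 2 * qRe (qinner f g) + (norm g)\<^sup>2"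
proof -
  have "qRe (qinner g f) = qRe (qinner f g)"
    by (subst qinner_cnj) simp
  moreover have "qRe (qinner h h) = (norm h)\<^sup>2" for h :: 'a
    by (simp only: qinner_self of_real_quat_sel)
  moreover have "qRe (qinner (f + g) (f + g)) = qRe (qinner f f) + qRe (qinner g f) + (qRe (qinner f g) + qRe (qinner g g))"
    by (simp only: qinner_add_left qinner_add_right plus_quat.sel)
  ultimately show ?thesis
    by simp
qed

text \<open>Cauchy-Schwarz is read off from the triangle inequality, which the normed-space
  superclass already supplies: a unit quaternion \<open>q\<close> turns
  \<open>qinner f (g *\<^sub>Q q)\<close> into the real number \<open>norm (qinner f g)\<close>, and
  squaring the triangle inequality for \<open>f\<close> and \<open>g *\<^sub>Q q\<close> isolates
  it.\<close>

lemma norm_qinner_le: "norm (qinner f g) \<le> norm f * norm (g::'a::rquat_hilbert)"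
proof (cases "qinner f g = 0")
  case False
  define q where "q = qcnj (qinner f g) /\<^sub>R norm (qinner f g)"
  have q: "norm q = 1" "qRe (qinner f g * q) = norm (qinner f g)"
    using False by (simp_all add: q_def qcnj_mult_self power2_eq_square del: of_real_power)
  have "(norm (f + g *\<^sub>Q q))\<^sup>2 \<le> (norm f + norm (g *\<^sub>Q q))\<^sup>2"
    by (intro power_mono norm_triangle_ineq) simp
  then have "qRe (qinner f (g *\<^sub>Q q)) \<le> norm f * norm (g *\<^sub>Q q)"
    by (simp add: norm_add_square power2_sum)
  then show ?thesis
    using q by (simp add: qinner_scaleQ_right norm_scaleQ)
qed simp

section \<open>Bounded operators\<close>

lemma bounded_qopsI:
  assumes "\<And>x y. A (x + y) = A x + A y" "\<And>x q. A (x *\<^sub>Q q) = A x *\<^sub>Q q" "\<And>x. norm (A x) \<le> C * norm x"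
  shows "A \<in> bounded_qops"
  unfolding bounded_qops_def
  using assms by (auto intro!: bounded_linear_intro[where K = C] simp: scaleR_scaleQ mult.commute)

lemma bounded_qops_linear: "A \<in> bounded_qops \<Longrightarrow> bounded_linear A"
  by (simp add: bounded_qops_def)

lemma
  assumes "A \<in> bounded_qops"
  shows qop_add: "A (x + y) = A x + A y"
    and qop_diff: "A (x - y) = A x - A y"
    and qop_minus: "A (- x) = - A x"
    and qop_zero: "A 0 = 0"
    and qop_scaleR: "A (r *\<^sub>R x) = r *\<^sub>R A x"
    and qop_scaleQ: "A (x *\<^sub>Q q) = A x *\<^sub>Q q"
    and qop_sum: "A (\<Sum>i\<in>I. f i) = (\<Sum>i\<in>I. A (f i))"
proof -
  interpret bounded_linear A by (rule bounded_qops_linear) fact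
  show "A (x + y) = A x + A y" "A (x - y) = A x - A y" "A (- x) = - A x" "A 0 = 0"
    "A (r *\<^sub>R x) = r *\<^sub>R A x" "A (\<Sum>i\<in>I. f i) = (\<Sum>i\<in>I. A (f i))"
    by (simp_all add: add diff neg zero scaleR sum)
  show "A (x *\<^sub>Q q) = A x *\<^sub>Q q"
    using assms by (simp add: bounded_qops_def)
qed

lemma qop_bound:
  assumes "A \<in> bounded_qops"
  obtains C where "C > 0" "\<And>x. norm (A x) \<le> C * norm x"
  using bounded_linear.pos_bounded[OF bounded_qops_linear[OF assms]] by (metis mult.commute)

lemma qop_plus: "A \<in> bounded_qops \<Longrightarrow> B \<in> bounded_qops \<Longrightarrow> (\<lambda>x. A x + B x) \<in> bounded_qops"
  by (simp add: bounded_qops_def scaleQ_add_left bounded_linear_add)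

lemma qop_sub: "A \<in> bounded_qops \<Longrightarrow> B \<in> bounded_qops \<Longrightarrow> (\<lambda>x. A x - B x) \<in> bounded_qops"
  by (simp add: bounded_qops_def scaleQ_diff_left bounded_linear_sub)

lemma qop_uminus: "A \<in> bounded_qops \<Longrightarrow> (\<lambda>x. - A x) \<in> bounded_qops"
  by (simp add: bounded_qops_def bounded_linear_minus)

lemma qop_comp: "A \<in> bounded_qops \<Longrightarrow> B \<in> bounded_qops \<Longrightarrow> (\<lambda>x. A (B x)) \<in> bounded_qops"
  unfolding bounded_qops_def using bounded_linear_compose[of A B] by simp

lemma qop_scaled: "A \<in> bounded_qops \<Longrightarrow> (\<lambda>x. r *\<^sub>R A x) \<in> bounded_qops"
  unfolding bounded_qops_def using bounded_linear_const_scaleR[of A r] by (simp add: scaleR_scaleQ_commute)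

lemma qop_id: "(\<lambda>x. x) \<in> bounded_qops"
  by (auto simp: bounded_qops_def)

lemma qop_const_zero: "(\<lambda>x. 0) \<in> bounded_qops"
  by (auto simp: bounded_qops_def)

lemma qop_sum_ops:
  assumes "\<And>i. i \<in> I \<Longrightarrow> A i \<in> bounded_qops"
  shows "(\<lambda>x. \<Sum>i\<in>I. A i x) \<in> bounded_qops"
  using assms by (induction I rule: infinite_finite_induct) (simp_all add: qop_const_zero qop_plus)

lemma Q_op_in_bounded_qops: "T \<in> bounded_qops \<Longrightarrow> Q_op q T \<in> bounded_qops"
  unfolding Q_op_def by (intro qop_plus qop_sub qop_scaled qop_id qop_comp[of T T])

lemma qop_rank_one: "(\<lambda>x. b *\<^sub>Q (p * qinner a x)) \<in> bounded_qops"
proof (rule bounded_qopsI)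
  show "norm (b *\<^sub>Q (p * qinner a x)) \<le> (norm b * norm p * norm a) * norm x" for x
    using mult_left_mono[OF norm_qinner_le[of a x], of "norm b * norm p"]
    by (simp add: norm_scaleQ norm_mult mult.assoc)
qed (simp_all add: qinner_add_right qinner_scaleQ_right scaleQ_add_right scaleQ_scaleQ distrib_left mult.assoc)

section \<open>Finite-dimensional subspaces\<close>

text \<open>Intended for finite \<open>B\<close>; for infinite \<open>B\<close> every sum is 0 by
  convention and the span collapses to \<open>{0}\<close>.\<close>

definition qspan :: "'v::rquat_vector set \<Rightarrow> 'v set" where
  "qspan B = range (\<lambda>c. \<Sum>b\<in>B. b *\<^sub>Q c b)"

lemma qspan_iff: "x \<in> qspan B \<longleftrightarrow> (\<exists>c. x = (\<Sum>b\<in>B. b *\<^sub>Q c b))"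
  by (auto simp: qspan_def)

lemma qspan_add: "x \<in> qspan B \<Longrightarrow> y \<in> qspan B \<Longrightarrow> x + y \<in> qspan B"
proof -
  assume "x \<in> qspan B" "y \<in> qspan B"
  then obtain c d where "x = (\<Sum>b\<in>B. b *\<^sub>Q c b)" "y = (\<Sum>b\<in>B. b *\<^sub>Q d b)"
    by (auto simp: qspan_iff)
  then have "x + y = (\<Sum>b\<in>B. b *\<^sub>Q (c b + d b))"
    by (simp add: scaleQ_add_right sum.distrib)
  then show ?thesis by (auto simp: qspan_iff)
qed

lemma qspan_scaleQ: "x \<in> qspan B \<Longrightarrow> x *\<^sub>Q q \<in> qspan B"
proof -
  assume "x \<in> qspan B"
  then obtain c where "x = (\<Sum>b\<in>B. b *\<^sub>Q c b)"
    by (auto simp: qspan_iff)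
  then have "x *\<^sub>Q q = (\<Sum>b\<in>B. b *\<^sub>Q (c b * q))"
    by (simp add: scaleQ_sum_left scaleQ_scaleQ)
  then show ?thesis by (auto simp: qspan_iff)
qed

lemma qspan_zero: "0 \<in> qspan B"
  unfolding qspan_iff by (rule exI[of _ "\<lambda>_. 0"]) simp

lemma qspan_minus: "x \<in> qspan B \<Longrightarrow> - x \<in> qspan B"
  using qspan_scaleQ[of x B "- 1"] by (simp add: scaleQ_one)

lemma qspan_diff: "x \<in> qspan B \<Longrightarrow> y \<in> qspan B \<Longrightarrow> x - y \<in> qspan B"
  using qspan_add[of x B "- y"] qspan_minus[of y B] by simp

lemma qspan_sum: "(\<And>i. i \<in> I \<Longrightarrow> f i \<in> qspan B) \<Longrightarrow> (\<Sum>i\<in>I. f i) \<in> qspan B"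
  by (induction I rule: infinite_finite_induct) (simp_all add: qspan_zero qspan_add)

lemma qspan_superset:
  assumes "finite B" "b \<in> B" shows "b \<in> qspan B"
  unfolding qspan_iff
  using assms by (intro exI[of _ "\<lambda>x. if x = b then 1 else 0"])
    (simp add: if_distrib[of "(*\<^sub>Q) _"] scaleQ_one cong: if_cong)

lemma qspan_minimal:
  assumes "B \<subseteq> qspan C" shows "qspan B \<subseteq> qspan C"
proof
  fix x assume "x \<in> qspan B"
  then obtain c where "x = (\<Sum>b\<in>B. b *\<^sub>Q c b)" by (auto simp: qspan_iff)
  with assms show "x \<in> qspan C"
    by (auto intro!: qspan_sum qspan_scaleQ)
qed

lemma qspan_mono: "finite C \<Longrightarrow> B \<subseteq> C \<Longrightarrow> qspan B \<subseteq> qspan C"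
  by (intro qspan_minimal) (auto intro: qspan_superset)

lemma subspace_qspan: "subspace (qspan B :: 'v::rquat_hilbert set)"
  unfolding subspace_def by (auto simp: qspan_zero qspan_add qspan_scaleQ scaleR_scaleQ)

text \<open>Each \<open>b\<close> contributes the four real generators b, bi, bj, bk. Together with
  the next lemma this moves finite-dimensionality between the quaternionic and the real structure,
  so that dimension counts can be done over the reals.\<close>

lemma qspan_subset_span:
  fixes B :: "'v::rquat_hilbert set"
  assumes "finite B"
  obtains G where "finite G" "qspan B \<subseteq> span G"
proof -
  define G where "G = (\<lambda>(b, q). b *\<^sub>Q q) ` (B \<times> {1, Quat 0 1 0 0, Quat 0 0 1 0, Quat 0 0 0 1})"
  have "b *\<^sub>Q q \<in> span G" if "b \<in> B" for b q
  proof -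
    have "q = qRe q *\<^sub>R 1 + qI q *\<^sub>R Quat 0 1 0 0 + qJ q *\<^sub>R Quat 0 0 1 0 + qK q *\<^sub>R Quat 0 0 0 1"
      by (simp add: quat_eq_iff)
    then have q: "q = 1 * of_real (qRe q) + Quat 0 1 0 0 * of_real (qI q) + Quat 0 0 1 0 * of_real (qJ q) + Quat 0 0 0 1 * of_real (qK q)"
      by (simp add: scaleR_conv_of_real of_real_quat_commute)
    have "b *\<^sub>Q q = qRe q *\<^sub>R (b *\<^sub>Q 1) + qI q *\<^sub>R (b *\<^sub>Q Quat 0 1 0 0) + qJ q *\<^sub>R (b *\<^sub>Q Quat 0 0 1 0) + qK q *\<^sub>R (b *\<^sub>Q Quat 0 0 0 1)"
      by (subst q) (simp add: scaleR_scaleQ scaleQ_add_right scaleQ_scaleQ scaleQ_one)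
    moreover have "b *\<^sub>Q p \<in> span G" if "p \<in> {1, Quat 0 1 0 0, Quat 0 0 1 0, Quat 0 0 0 1}" for p
      using \<open>b \<in> B\<close> that by (intro span_base) (force simp: G_def)
    ultimately show ?thesis
      by (simp add: span_add span_scale)
  qed
  then have "qspan B \<subseteq> span G"
    by (auto simp: qspan_iff intro!: span_sum)
  moreover have "finite G" by (simp add: G_def assms)
  ultimately show thesis using that by blast
qed

text \<open>A real basis of \<open>W\<close> also generates it over the quaternions, in general
  redundantly.\<close>

lemma subset_span_imp_qspan:
  fixes W :: "'v::rquat_hilbert set"
  assumes "W \<subseteq> span G" "finite G"
  obtains B where "finite B" "B \<subseteq> W" "W \<subseteq> qspan B"
proof -
  obtain B where B: "B \<subseteq> W" "independent B" "W \<subseteq> span B"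
    by (rule maximal_independent_subset)
  then have "finite B"
    using independent_span_bound[OF assms(2) B(2)] assms(1) by blast
  moreover have "span B \<subseteq> qspan B"
    by (intro span_minimal subspace_qspan) (auto intro: qspan_superset \<open>finite B\<close>)
  ultimately show thesis using B that by blast
qed

section \<open>Orthonormal systems and orthogonal projections\<close>

definition qorthonormal :: "'v::rquat_hilbert set \<Rightarrow> bool" where
  "qorthonormal B \<longleftrightarrow> finite B \<and> (\<forall>b\<in>B. \<forall>c\<in>B. qinner b c = (if b = c then 1 else 0))"

definition qproj :: "'v::rquat_hilbert set \<Rightarrow> 'v \<Rightarrow> 'v" where
  "qproj B x = (\<Sum>b\<in>B. b *\<^sub>Q qinner b x)"

lemma qproj_in_qspan: "qproj B x \<in> qspan B"
  by (auto simp: qproj_def qspan_iff)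

lemma qproj_in_bounded_qops: "qproj B \<in> bounded_qops"
  unfolding qproj_def[abs_def] using qop_rank_one[of _ 1] by (intro qop_sum_ops) simp

lemma qproj_coefficients:
  assumes "qorthonormal B" "b \<in> B"
  shows "qinner b (\<Sum>c\<in>B. c *\<^sub>Q k c) = k b"
proof -
  have "qinner b (\<Sum>c\<in>B. c *\<^sub>Q k c) = (\<Sum>c\<in>B. if c = b then k c else 0)"
    unfolding qinner_sum_right qinner_scaleQ_right
    using assms by (intro sum.cong) (auto simp: qorthonormal_def)
  also have "\<dots> = k b"
    using assms by (auto simp: qorthonormal_def)
  finally show ?thesis .
qed

lemma qproj_fixes:
  assumes "qorthonormal B" "x \<in> qspan B"
  shows "qproj B x = x"
proof -
  obtain c where x: "x = (\<Sum>b\<in>B. b *\<^sub>Q c b)"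
    using assms(2) by (auto simp: qspan_iff)
  show ?thesis
    unfolding qproj_def using qproj_coefficients[OF assms(1)] by (simp add: x)
qed

lemma qproj_residual_orthogonal:
  assumes "qorthonormal B" "z \<in> qspan B"
  shows "qinner (x - qproj B x) z = 0"
proof -
  have "qinner b (x - qproj B x) = 0" if "b \<in> B" for b
    using qproj_coefficients[OF assms(1) that] by (simp add: qproj_def qinner_diff_right)
  then have "qinner (x - qproj B x) b = 0" if "b \<in> B" for b
    using that by (subst qinner_cnj) simp
  then show ?thesis
    using assms(2) by (auto simp: qspan_iff qinner_sum_right qinner_scaleQ_right)
qed

lemma qproj_closest:
  assumes "qorthonormal B" "w \<in> qspan B"
  shows "norm (x - qproj B x) \<le> norm (x - w)"
proof -
  have "(norm (x - qproj B x + (qproj B x - w)))\<^sup>2 = (norm (x - qproj B x))\<^sup>2 + (norm (qproj B x - w))\<^sup>2"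
    unfolding norm_add_square
    by (subst qproj_residual_orthogonal[OF assms(1) qspan_diff[OF qproj_in_qspan assms(2)]]) simp
  then have "(norm (x - qproj B x))\<^sup>2 \<le> (norm (x - w))\<^sup>2"
    by simp
  then show ?thesis by (rule power2_le_imp_le) simp
qed

text \<open>A vector whose residual after projection vanishes is dropped, whence the inequality
  between the cardinalities. That bound later fits an orthonormal basis of a null space into the
  codimension of a range.\<close>

lemma Gram_Schmidt:
  fixes G :: "'v::rquat_hilbert set"
  assumes "finite G"
  obtains B where "qorthonormal B" "qspan B = qspan G" "card B \<le> card G"
proof -
  have "\<exists>B. qorthonormal B \<and> qspan B = qspan G \<and> card B \<le> card G"
    using assms
  proof (induction G rule: finite_induct)
    case empty
    then show ?case by (intro exI[of _ "{}"]) (simp add: qorthonormal_def)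
  next
    case (insert g G)
    then obtain B where B: "qorthonormal B" "qspan B = qspan G" "card B \<le> card G" by blast
    have fin: "finite B" using B by (simp add: qorthonormal_def)
    have G: "G \<subseteq> qspan B" unfolding B using insert by (auto intro: qspan_superset)
    have BG: "B \<subseteq> qspan (insert g G)"
      using qspan_superset[OF fin] qspan_mono[of "insert g G" G] insert B(2) by blast
    define r where "r = g - qproj B g"
    show ?case
    proof (cases "r = 0")
      case True
      then have "g \<in> qspan B" using qproj_in_qspan[of B g] by (simp add: r_def)
      then have "qspan B = qspan (insert g G)"
        using qspan_minimal[of "insert g G" B] qspan_minimal[OF BG] G by auto
      with B insert show ?thesis by (intro exI[of _ B]) auto
    next
      case False
      define e where "e = r *\<^sub>Q of_real (1 / norm r)"
      have g: "g = e *\<^sub>Q of_real (norm r) + qproj B g"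
      proof -
        have "e *\<^sub>Q of_real (norm r) = r"
          using False by (simp only: e_def scaleQ_scaleQ of_real_mult[symmetric]) (simp add: scaleQ_one)
        then show ?thesis by (simp add: r_def)
      qed
      have ee: "qinner e e = 1"
        using False unfolding e_def qinner_scaleQ_left qinner_scaleQ_right
        by (simp only: qinner_self qcnj_of_real of_real_mult[symmetric]) (simp add: power2_eq_square)
      have eb: "qinner e b = 0" if "b \<in> B" for b
        using qproj_residual_orthogonal[OF B(1) qspan_superset[OF fin that], of g]
        by (simp add: e_def r_def qinner_scaleQ_left)
      have be: "qinner b e = 0" if "b \<in> B" for b
        using eb[OF that] by (subst qinner_cnj) simp
      have on: "qorthonormal (insert e B)"
        using B(1) ee eb be fin by (auto simp: qorthonormal_def)
      have e_in: "e \<in> qspan (insert e B)" "qspan B \<subseteq> qspan (insert e B)"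
        using qspan_superset[of "insert e B" e] qspan_mono[of "insert e B" B] fin by blast+
      have "insert g G \<subseteq> qspan (insert e B)"
      proof -
        have "g \<in> qspan (insert e B)"
          using e_in qproj_in_qspan[of B g]
          by (subst g, intro qspan_add qspan_scaleQ) auto
        then show ?thesis using G e_in by blast
      qed
      moreover have "e \<in> qspan (insert g G)"
        unfolding e_def r_def
        using qproj_in_qspan[of B g] qspan_minimal[OF BG] qspan_superset[of "insert g G" g] insert
        by (intro qspan_scaleQ qspan_diff) auto
      ultimately have "qspan (insert e B) = qspan (insert g G)"
        using BG by (intro equalityI qspan_minimal) simp_all
      moreover have "card (insert e B) \<le> card (insert g G)"
        using B(3) fin insert by (auto simp: card_insert_if)
      ultimately show ?thesis using on by blast
    qed
  qed
  then show thesis using that by blast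
qed

lemma closed_qspan:
  fixes B :: "'v::rquat_hilbert set"
  assumes "finite B"
  shows "closed (qspan B)"
proof -
  obtain E where E: "qorthonormal E" "qspan E = qspan B"
    using Gram_Schmidt[OF assms] by metis
  have "qspan E = {x. qproj E x = x}"
    using qproj_fixes[OF E(1)] qproj_in_qspan[of E] by (auto, metis)
  moreover have "closed {x. qproj E x = x}"
    by (intro closed_Collect_eq continuous_intros
        linear_continuous_on bounded_qops_linear qproj_in_bounded_qops)
  ultimately show ?thesis using E by simp
qed

section \<open>The closed graph theorem\<close>

text \<open>Stated for a closed subspace because it is also applied to inverses defined only on a
  closed range. By Baire, the closure of some set where \<open>norm (f x)\<close> is at most
  \<open>n\<close> contains a relative ball. Hence every \<open>x\<close> is approximated up to half
  its norm by a point with controlled image; iterating gives a series for \<open>x\<close> whose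
  images converge absolutely, and the graph hypothesis identifies the limit with
  \<open>f x\<close>.\<close>

lemma closed_graph_on_subspace:
  fixes f :: "'a::banach \<Rightarrow> 'b::banach"
  assumes X: "subspace X" "closed X"
    and add: "\<And>x y. x \<in> X \<Longrightarrow> y \<in> X \<Longrightarrow> f (x + y) = f x + f y"
    and scale: "\<And>r x. x \<in> X \<Longrightarrow> f (r *\<^sub>R x) = r *\<^sub>R f x"
    and graph: "\<And>s x y. (\<And>n. s n \<in> X) \<Longrightarrow> s \<longlonglongrightarrow> x \<Longrightarrow> (\<lambda>n. f (s n)) \<longlonglongrightarrow> y \<Longrightarrow> f x = y"
  obtains C where "\<And>x. x \<in> X \<Longrightarrow> norm (f x) \<le> C * norm x"
proof -
  define A where "A n = {x \<in> X. norm (f x) \<le> real n}" for n :: nat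
  have AX: "closure (A n) \<subseteq> X" for n
    by (rule closure_minimal) (auto simp: A_def X)
  have diff: "f (x - y) = f x - f y" if "x \<in> X" "y \<in> X" for x y
    using add[of x "(-1) *\<^sub>R y"] scale[of y "-1"] that subspace_neg[OF X(1) that(2)] by simp
  have zero: "f 0 = 0"
    using scale[of 0 0] subspace_0[OF X(1)] by simp
  obtain n where n: "top_of_set X interior_of closure (A n) \<noteq> {}"
  proof (rule ccontr)
    assume "\<not> thesis"
    then have "\<And>n. top_of_set X interior_of closure (A n) = {}" using that by blast
    moreover have "completely_metrizable_space (top_of_set X)"
      by (rule completely_metrizable_space_closedin[OF completely_metrizable_space_euclidean])
        (use X in simp)
    moreover have "closedin (top_of_set X) (closure (A n))" for n
      by (rule closed_subset[OF AX closed_closure])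
    ultimately have "top_of_set X interior_of \<Union> (range (\<lambda>n. closure (A n))) = {}"
      by (intro Baire_category_alt) auto
    moreover have "X \<subseteq> \<Union> (range (\<lambda>n. closure (A n)))"
    proof
      fix x assume "x \<in> X"
      then have "x \<in> A (nat \<lceil>norm (f x)\<rceil>)" by (simp add: A_def of_nat_ceiling)
      then show "x \<in> \<Union> (range (\<lambda>n. closure (A n)))" using closure_subset by blast
    qed
    then have "\<Union> (range (\<lambda>n. closure (A n))) = X" using AX by blast
    moreover have "top_of_set X interior_of X = X"
      by (metis interior_of_topspace topspace_euclidean_subtopology)
    ultimately show False using subspace_0[OF X(1)] by auto
  qed
  then obtain x0 U where U: "openin (top_of_set X) U" "x0 \<in> U" "U \<subseteq> closure (A n)"
    unfolding interior_of_def by blast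
  obtain e where e: "e > 0" "\<And>x. x \<in> X \<Longrightarrow> dist x x0 < e \<Longrightarrow> x \<in> U"
    using U(1,2) unfolding openin_euclidean_subtopology_iff by blast
  have x0: "x0 \<in> X" using U AX by blast
  \<comment> \<open>Differences of two points of \<open>A n\<close> move the ball from
    \<open>x0\<close> to the origin, at the price of the factor 2.\<close>
  have approx: "\<exists>a\<in>X. norm (z - a) < d \<and> norm (f a) \<le> 2 * real n"
    if z: "z \<in> X" "norm z < e" and d: "d > 0" for z d
  proof -
    have "x0 + z \<in> closure (A n)" "x0 \<in> closure (A n)"
      using e U z x0 subspace_add[OF X(1)] by (auto simp: dist_norm)
    then obtain u v where uv: "u \<in> A n" "dist u (x0 + z) < d / 2" "v \<in> A n" "dist v x0 < d / 2"
      using d unfolding closure_approachable by (meson half_gt_zero)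
    have "norm (z - (u - v)) = norm ((v - x0) - (u - (x0 + z)))"
      by (simp add: algebra_simps)
    also have "\<dots> < d"
      using norm_triangle_ineq4[of "v - x0" "u - (x0 + z)"] uv by (simp add: dist_norm)
    finally have "norm (z - (u - v)) < d" .
    moreover have "norm (f (u - v)) \<le> 2 * real n"
      using uv norm_triangle_ineq4[of "f u" "f v"] by (simp add: A_def diff)
    ultimately show ?thesis
      using uv subspace_diff[OF X(1)] by (auto simp: A_def)
  qed
  \<comment> \<open>\<open>x\<close> is rescaled to norm \<open>e / 2\<close>; scaling the bound
    \<open>2 * n\<close> back multiplies it by \<open>2 * norm x / e\<close>.\<close>
  define M where "M = 4 * real n / e"
  have "\<exists>a\<in>X. norm (x - a) \<le> norm x / 2 \<and> norm (f a) \<le> M * norm x" if x: "x \<in> X" for x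
  proof (cases "x = 0")
    case True
    then show ?thesis using x zero by (intro bexI[of _ 0]) auto
  next
    case False
    define t where "t = e / (2 * norm x)"
    have t: "t > 0" using False e by (simp add: t_def)
    have "norm (t *\<^sub>R x) < e" using False e t by (simp add: t_def)
    then obtain a where a: "a \<in> X" "norm (t *\<^sub>R x - a) < t * (norm x / 2)" "norm (f a) \<le> 2 * real n"
      using approx[of "t *\<^sub>R x" "t * (norm x / 2)"] False t x subspace_scale[OF X(1)] by auto
    have "t * norm (x - a /\<^sub>R t) = norm (t *\<^sub>R (x - a /\<^sub>R t))" using t by simp
    also have "t *\<^sub>R (x - a /\<^sub>R t) = t *\<^sub>R x - a" using t by (simp add: scaleR_diff_right)
    finally have "t * norm (x - a /\<^sub>R t) < t * (norm x / 2)" using a by simp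
    then have "norm (x - a /\<^sub>R t) \<le> norm x / 2" using t by (simp only: mult_less_cancel_left_pos less_imp_le)
    moreover have "norm (f (a /\<^sub>R t)) \<le> M * norm x"
      using a t False e by (simp add: scale M_def t_def field_simps)
    ultimately show ?thesis using a subspace_scale[OF X(1)] by blast
  qed
  then obtain g where g: "\<And>x. x \<in> X \<Longrightarrow> g x \<in> X" "\<And>x. x \<in> X \<Longrightarrow> norm (x - g x) \<le> norm x / 2"
      "\<And>x. x \<in> X \<Longrightarrow> norm (f (g x)) \<le> M * norm x"
    by metis
  have M: "M \<ge> 0" using e by (simp add: M_def)
  have "norm (f x) \<le> (2 * M) * norm x" if x: "x \<in> X" for x
  proof -
    \<comment> \<open>The remainder after \<open>k\<close> corrections; its norm halves at each
      step, so the geometric series produces the final constant \<open>2 * M\<close>.\<close>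
    define r where "r k = ((\<lambda>y. y - g y) ^^ k) x" for k
    have rS: "r (Suc k) = r k - g (r k)" for k by (simp add: r_def)
    have rX: "r k \<in> X" for k
      by (induction k) (simp_all add: rS x g subspace_diff[OF X(1)], simp add: r_def x)
    have rn: "norm (r k) \<le> norm x * (1/2) ^ k" for k
    proof (induction k)
      case (Suc k)
      then show ?case using g(2)[OF rX[of k]] by (simp add: rS)
    qed (simp add: r_def)
    have fb: "norm (f (g (r k))) \<le> M * norm x * (1/2) ^ k" for k
      using g(3)[OF rX[of k]] mult_left_mono[OF rn[of k] M] by (simp add: mult.assoc)
    have geo: "(\<lambda>k. M * norm x * (1/2) ^ k) sums (M * norm x * 2)"
      using sums_mult[OF geometric_sums[of "1/2::real"], of "M * norm x"] by simp
    have summ: "summable (\<lambda>k. norm (f (g (r k))))"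
      by (rule summable_comparison_test'[OF sums_summable[OF geo]]) (use fb in auto)
    define s where "s n = (\<Sum>k<n. g (r k))" for n
    have sr: "s n = x - r n" for n
      by (induction n) (simp_all add: s_def rS, simp add: r_def)
    have sX: "s n \<in> X" for n
      by (simp add: sr x rX subspace_diff[OF X(1)])
    have fs: "f (s n) = (\<Sum>k<n. f (g (r k)))" for n
    proof (induction n)
      case (Suc n)
      then show ?case using add[OF sX[of n] g(1)[OF rX[of n]]] by (simp add: s_def)
    qed (simp add: s_def zero)
    have "(\<lambda>n. norm x * (1/2) ^ n) \<longlonglongrightarrow> 0"
      by (intro tendsto_mult_right_zero LIMSEQ_power_zero) simp
    then have "r \<longlonglongrightarrow> 0"
      by (rule Lim_null_comparison[rotated]) (simp add: rn)
    then have "s \<longlonglongrightarrow> x"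
      unfolding sr[abs_def] using tendsto_diff[of "\<lambda>_. x" x sequentially r 0] by simp
    moreover have "(\<lambda>n. f (s n)) \<longlonglongrightarrow> (\<Sum>k. f (g (r k)))"
      unfolding fs by (rule summable_LIMSEQ[OF summable_norm_cancel[OF summ]])
    ultimately have "f x = (\<Sum>k. f (g (r k)))"
      using graph sX by blast
    also have "norm \<dots> \<le> (\<Sum>k. norm (f (g (r k))))"
      by (rule summable_norm[OF summ])
    also have "\<dots> \<le> M * norm x * 2"
      using suminf_le[OF fb summ sums_summable[OF geo]] sums_unique[OF geo] by simp
    finally show ?thesis by simp
  qed
  then show thesis using that by blast
qed

text \<open>The bounded inverse theorem: the graph of the inverse is closed because \<open>A\<close>
  is continuous, and linearity follows from injectivity.\<close>

lemma qop_inverse: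
  assumes A: "A \<in> bounded_qops" and bij: "bij A"
  shows "inv_into UNIV A \<in> bounded_qops"
proof -
  have inv: "A (inv_into UNIV A y) = y" for y
    using bij by (simp add: bij_is_surj surj_f_inv_f)
  have inj: "x = y" if "A x = A y" for x y
    using bij that by (auto dest: bij_is_inj injD)
  have add: "inv_into UNIV A (x + y) = inv_into UNIV A x + inv_into UNIV A y" for x y
    by (rule inj) (simp add: inv qop_add[OF A])
  obtain C where "\<And>x. x \<in> UNIV \<Longrightarrow> norm (inv_into UNIV A x) \<le> C * norm x"
  proof (rule closed_graph_on_subspace[of UNIV "inv_into UNIV A"])
    show "inv_into UNIV A (r *\<^sub>R x) = r *\<^sub>R inv_into UNIV A x" for r x
      by (rule inj) (simp add: inv qop_scaleR[OF A])
    show "inv_into UNIV A x = y" if "s \<longlonglongrightarrow> x" "(\<lambda>n. inv_into UNIV A (s n)) \<longlonglongrightarrow> y" for s x y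
    proof -
      have "(\<lambda>n. A (inv_into UNIV A (s n))) \<longlonglongrightarrow> A y"
        by (rule bounded_linear.tendsto[OF bounded_qops_linear[OF A] that(2)])
      then have "A y = x"
        using LIMSEQ_unique that(1) by (auto simp: inv)
      then show ?thesis using inv inj by metis
    qed
  qed (auto simp: add)
  then show ?thesis
    by (intro bounded_qopsI[of _ C]) (auto simp: add inv qop_scaleQ[OF A] intro: inj)
qed

text \<open>Solving \<open>C x + E x = y\<close> means finding a fixed point of the map sending
  \<open>x\<close> to the preimage of \<open>y - E x\<close> under \<open>C\<close>, a contraction
  with factor \<open>c * d\<close>. The constants \<open>c\<close> and \<open>d\<close> stand in for
  the operator norms of the inverse of \<open>C\<close> and of \<open>E\<close>.\<close>

lemma bij_perturbation:
  assumes C: "C \<in> bounded_qops" "bij C" "\<And>x. norm x \<le> c * norm (C x)" and E: "E \<in> bounded_qops"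
    "\<And>x. norm (E x) \<le> d * norm x" and cd: "c * d < 1" "0 \<le> c" "0 \<le> d"
  shows "bij (\<lambda>x. C x + E x)"
proof -
  have inv: "C (inv_into UNIV C y) = y" "inv_into UNIV C (C y) = y" for y
    using C(2) by (simp_all add: bij_is_surj surj_f_inv_f bij_is_inj)
  have "\<exists>!x. C x + E x = y" for y
  proof -
    have "\<exists>!x\<in>UNIV. inv_into UNIV C (y - E x) = x"
    proof (rule Banach_fix[OF _ _ _ cd(1)])
      show "dist (inv_into UNIV C (y - E u)) (inv_into UNIV C (y - E v)) \<le> c * d * dist u v" for u v
      proof -
        have "dist (inv_into UNIV C (y - E u)) (inv_into UNIV C (y - E v)) \<le> c * norm (C (inv_into UNIV C (y - E u) - inv_into UNIV C (y - E v)))"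
          unfolding dist_norm by (rule C(3))
        also have "C (inv_into UNIV C (y - E u) - inv_into UNIV C (y - E v)) = E (v - u)"
          by (simp add: qop_diff[OF C(1)] qop_diff[OF E(1)] inv)
        also have "c * norm (E (v - u)) \<le> c * (d * norm (v - u))"
          by (intro mult_left_mono E cd)
        finally show ?thesis by (simp add: dist_norm norm_minus_commute mult.assoc)
      qed
    qed (auto simp: complete_UNIV cd)
    moreover have "inv_into UNIV C (y - E x) = x \<longleftrightarrow> C x + E x = y" for x
      by (metis inv add_diff_cancel_right' diff_add_cancel)
    ultimately show ?thesis by simp
  qed
  then show ?thesis
    by (simp add: bij_iff)
qed

section \<open>Compact operators\<close>

lemma compact_qopsD: "K \<in> compact_qops \<Longrightarrow> K \<in> bounded_qops"
  by (simp add: compact_qops_def)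

lemma compact_qopsI:
  assumes "K \<in> bounded_qops" "\<And>S. bounded S \<Longrightarrow> \<exists>D. compact D \<and> K ` S \<subseteq> D"
  shows "K \<in> compact_qops"
  unfolding compact_qops_def
proof (intro CollectI conjI allI impI)
  fix S :: "'a set" assume "bounded S"
  then obtain D where D: "compact D" "K ` S \<subseteq> D" using assms(2) by blast
  then have "closure (K ` S) = D \<inter> closure (K ` S)"
    using closure_minimal compact_imp_closed by blast
  then show "compact (closure (K ` S))"
    by (metis D(1) closed_closure compact_Int_closed)
qed fact

lemma compact_qop_image:
  assumes "K \<in> compact_qops" "bounded S"
  shows "\<exists>D. compact D \<and> K ` S \<subseteq> D"
  using assms closure_subset[of "K ` S"] by (auto simp: compact_qops_def)

lemma compact_qop_zero: "(\<lambda>x. 0) \<in> compact_qops"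
  by (rule compact_qopsI[OF qop_const_zero]) (auto intro!: exI[of _ "{0}"])

lemma compact_qop_plus:
  assumes "K \<in> compact_qops" "L \<in> compact_qops"
  shows "(\<lambda>x. K x + L x) \<in> compact_qops"
proof (rule compact_qopsI)
  fix S :: "'a set" assume "bounded S"
  then obtain D E where "compact D" "K ` S \<subseteq> D" "compact E" "L ` S \<subseteq> E"
    using assms compact_qop_image by metis
  then show "\<exists>D. compact D \<and> (\<lambda>x. K x + L x) ` S \<subseteq> D"
    by (intro exI[of _ "{x + y |x y. x \<in> D \<and> y \<in> E}"]) (blast intro: compact_sums)
qed (simp add: qop_plus assms compact_qopsD)

lemma compact_qop_comp_left:
  assumes "K \<in> compact_qops" "A \<in> bounded_qops"
  shows "(\<lambda>x. A (K x)) \<in> compact_qops"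
proof (rule compact_qopsI)
  fix S :: "'a set" assume "bounded S"
  then obtain D where "compact D" "K ` S \<subseteq> D"
    using assms compact_qop_image by metis
  then show "\<exists>D. compact D \<and> (\<lambda>x. A (K x)) ` S \<subseteq> D"
    by (intro exI[of _ "A ` D"])
       (auto intro!: compact_continuous_image linear_continuous_on bounded_qops_linear assms)
qed (simp add: qop_comp assms compact_qopsD)

lemma compact_qop_comp_right:
  assumes "K \<in> compact_qops" "A \<in> bounded_qops"
  shows "(\<lambda>x. K (A x)) \<in> compact_qops"
proof (rule compact_qopsI)
  fix S :: "'a set" assume "bounded S"
  then have "bounded (A ` S)"
    by (rule bounded_linear_image[OF _ bounded_qops_linear[OF assms(2)]])
  then show "\<exists>D. compact D \<and> (\<lambda>x. K (A x)) ` S \<subseteq> D"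
    using compact_qop_image[OF assms(1), of "A ` S"] by (simp add: image_image)
qed (simp add: qop_comp assms compact_qopsD)

lemma compact_qop_uminus: "K \<in> compact_qops \<Longrightarrow> (\<lambda>x. - K x) \<in> compact_qops"
  using compact_qop_comp_left[OF _ qop_uminus[OF qop_id], of K] by simp

lemma compact_qop_diff:
  "K \<in> compact_qops \<Longrightarrow> L \<in> compact_qops \<Longrightarrow> (\<lambda>x. K x - L x) \<in> compact_qops"
  using compact_qop_plus[OF _ compact_qop_uminus[of L], of K] by simp

lemma compact_qop_scaled: "K \<in> compact_qops \<Longrightarrow> (\<lambda>x. r *\<^sub>R K x) \<in> compact_qops"
  using compact_qop_comp_left[OF _ qop_scaled[OF qop_id], of K r] by simp

lemma compact_qop_sum:
  assumes "\<And>i. i \<in> I \<Longrightarrow> K i \<in> compact_qops"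
  shows "(\<lambda>x. \<Sum>i\<in>I. K i x) \<in> compact_qops"
  using assms by (induction I rule: infinite_finite_induct) (simp_all add: compact_qop_zero compact_qop_plus)

lemma compact_qop_subsequence:
  assumes "K \<in> compact_qops" "bounded (range s)"
  obtains l r where "strict_mono (r :: nat \<Rightarrow> nat)" "(\<lambda>n. K (s (r n))) \<longlonglongrightarrow> l"
proof -
  obtain D where "compact D" "K ` range s \<subseteq> D"
    using compact_qop_image[OF assms] by blast
  then obtain l r where "strict_mono r" "((\<lambda>n. K (s n)) \<circ> r) \<longlonglongrightarrow> l"
    unfolding compact_def by (metis (no_types, lifting) image_subset_iff rangeI)
  then show thesis using that by (simp add: o_def)
qed

text \<open>Each summand factors through the quaternions: a bounded set is sent into a compact ball
  of scalars, which then multiplies the fixed vector \<open>b\<close>.\<close>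

lemma compact_qproj: "qproj B \<in> compact_qops"
  unfolding qproj_def[abs_def]
proof (rule compact_qop_sum)
  fix b :: 'a
  have rk: "(\<lambda>x. b *\<^sub>Q qinner b x) \<in> bounded_qops"
    using qop_rank_one[of b 1 b] by simp
  show "(\<lambda>x. b *\<^sub>Q qinner b x) \<in> compact_qops"
  proof (rule compact_qopsI[OF rk])
    fix S :: "'a set" assume "bounded S"
    then obtain r where r: "\<And>x. x \<in> S \<Longrightarrow> norm x \<le> r" by (auto simp: bounded_iff)
    have bl: "bounded_linear (\<lambda>q. b *\<^sub>Q q)"
      by (rule bounded_linear_intro[where K = "norm b"])
        (simp_all add: scaleQ_add_right norm_scaleQ scaleR_scaleQ scaleQ_scaleQ scaleR_conv_of_real of_real_quat_commute mult.commute)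
    have "qinner b x \<in> cball 0 (norm b * r)" if "x \<in> S" for x
      using norm_qinner_le[of b x] mult_left_mono[OF r[OF that], of "norm b"] by simp
    then show "\<exists>D. compact D \<and> (\<lambda>x. b *\<^sub>Q qinner b x) ` S \<subseteq> D"
      by (intro exI[of _ "(\<lambda>q. b *\<^sub>Q q) ` cball 0 (norm b * r)"])
        (auto intro!: compact_continuous_image linear_continuous_on bl compact_quat_cball)
  qed
qed

definition finite_rank :: "('v::rquat_hilbert \<Rightarrow> 'v) \<Rightarrow> bool" where
  "finite_rank F \<longleftrightarrow> F \<in> bounded_qops \<and> (\<exists>B. finite B \<and> range F \<subseteq> qspan B)"

lemma finite_rank_compact:
  assumes "finite_rank F" shows "F \<in> compact_qops"
proof -
  obtain B where B: "finite B" "range F \<subseteq> qspan B" and F: "F \<in> bounded_qops"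
    using assms by (auto simp: finite_rank_def)
  obtain E where E: "qorthonormal E" "qspan E = qspan B"
    using Gram_Schmidt[OF B(1)] by metis
  have "qproj E (F x) = F x" for x
    using qproj_fixes[OF E(1), of "F x"] E(2) B(2) by (simp add: image_subset_iff)
  then show ?thesis
    using compact_qop_comp_right[OF compact_qproj F, of E] by simp
qed

text \<open>Take a finite \<open>e\<close>-net of the image of the unit ball and let
  \<open>F\<close> be \<open>K\<close> followed by the orthogonal projection onto the span of the
  net. The projection is the best approximation from that span, so its error is at most the distance
  to a point of the net.\<close>

lemma compact_qop_split:
  assumes K: "K \<in> compact_qops" and e: "e > 0"
  obtains F where "finite_rank F" "\<And>x. norm (K x - F x) \<le> e * norm x"
proof -
  obtain D where "compact D" "K ` cball 0 1 \<subseteq> D"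
    using compact_qop_image[OF K bounded_cball] by blast
  then obtain G where G: "finite G" "K ` cball 0 1 \<subseteq> (\<Union>y\<in>G. ball y e)"
    using e unfolding compact_eq_totally_bounded by (metis order_trans)
  obtain E where E: "qorthonormal E" "qspan E = qspan G"
    using Gram_Schmidt[OF G(1)] by metis
  define F where "F x = qproj E (K x)" for x
  have KB: "K \<in> bounded_qops" by (rule compact_qopsD[OF K])
  have FB: "F \<in> bounded_qops"
    unfolding F_def by (rule qop_comp[OF qproj_in_bounded_qops KB])
  have unit: "norm (K x - F x) \<le> e" if x: "norm x \<le> 1" for x
  proof -
    obtain y where "y \<in> G" "dist y (K x) < e"
    proof -
      have "K x \<in> K ` cball 0 1" using x by simp
      then have "K x \<in> (\<Union>y\<in>G. ball y e)" using G(2) by blast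
      then show ?thesis using that by auto
    qed
    moreover have "norm (K x - F x) \<le> norm (K x - y)"
      unfolding F_def using qspan_superset[OF G(1)] \<open>y \<in> G\<close> E by (intro qproj_closest) auto
    ultimately show ?thesis by (simp add: dist_norm norm_minus_commute)
  qed
  have "norm (K x - F x) \<le> e * norm x" for x
  proof (cases "x = 0")
    case True
    then show ?thesis by (simp add: qop_zero[OF KB] qop_zero[OF FB])
  next
    case False
    have "norm (x /\<^sub>R norm x) \<le> 1" using False by simp
    from unit[OF this] have "norm (K x - F x) / norm x \<le> e"
      using False by (simp add: qop_scaleR[OF KB] qop_scaleR[OF FB] divide_inverse mult.commute
          flip: scaleR_diff_right)
    then show ?thesis using False by (simp add: divide_le_eq)
  qed
  moreover have "finite_rank F"
    unfolding finite_rank_def using FB E(1) qproj_in_qspan[of E]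
    by (auto simp: F_def qorthonormal_def intro!: exI[of _ E])
  ultimately show thesis using that by blast
qed

section \<open>The Calkin algebra\<close>

lemma qop_ring_simps [simp]:
  "carrier qop_ring = bounded_qops" "mult qop_ring = (\<circ>)" "one qop_ring = id"
  "zero qop_ring = (\<lambda>x. 0)" "add qop_ring = (\<lambda>S T x. S x + T x)"
  by (simp_all add: qop_ring_def)

lemma ring_qop_ring: "ring (qop_ring :: ('v::rquat_hilbert \<Rightarrow> 'v) ring)"
proof (rule ringI)
  show "abelian_group (qop_ring :: ('v \<Rightarrow> 'v) ring)"
  proof (rule abelian_groupI)
    show "\<exists>y\<in>carrier qop_ring. y \<oplus>\<^bsub>qop_ring\<^esub> x = \<zero>\<^bsub>qop_ring\<^esub>"
      if "x \<in> carrier qop_ring" for x :: "'v \<Rightarrow> 'v"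
      using that by (intro bexI[of _ "\<lambda>v. - x v"]) (simp_all add: qop_uminus)
  qed (simp_all add: qop_plus qop_const_zero add_ac)
  show "Group.monoid (qop_ring :: ('v \<Rightarrow> 'v) ring)"
    by (rule monoidI) (simp_all add: o_def id_def qop_comp qop_id)
qed (auto simp: fun_eq_iff qop_add)

lemma a_inv_qop_ring:
  assumes "A \<in> bounded_qops" shows "\<ominus>\<^bsub>qop_ring\<^esub> A = (\<lambda>x. - A x)"
proof -
  interpret ring "qop_ring :: ('a \<Rightarrow> 'a) ring" by (rule ring_qop_ring)
  show ?thesis
    by (rule minus_equality) (simp_all add: assms qop_uminus)
qed

lemma ideal_compact_qops: "ideal compact_qops (qop_ring :: ('v::rquat_hilbert \<Rightarrow> 'v) ring)"
proof -
  interpret ring "qop_ring :: ('v \<Rightarrow> 'v) ring" by (rule ring_qop_ring)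
  show ?thesis
  proof (rule idealI[OF ring_qop_ring])
    show "subgroup compact_qops (add_monoid (qop_ring :: ('v \<Rightarrow> 'v) ring))"
    proof (rule group.subgroupI[OF a_group])
      show "inv\<^bsub>add_monoid qop_ring\<^esub> K \<in> compact_qops" if "K \<in> compact_qops" for K :: "'v \<Rightarrow> 'v"
        using a_inv_qop_ring[OF compact_qopsD[OF that]] compact_qop_uminus[OF that]
        by (simp add: a_inv_def)
    qed (auto simp: compact_qopsD compact_qop_plus intro: compact_qop_zero)
  qed (auto simp: o_def compact_qop_comp_left compact_qop_comp_right)
qed

text \<open>By the bounded inverse theorem, invertibility in the operator ring reduces to
  bijectivity.\<close>

lemma Units_qop_ring: "Units qop_ring = {A \<in> bounded_qops. bij A}"
proof (intro equalityI subsetI)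
  fix A :: "'a \<Rightarrow> 'a" assume "A \<in> Units qop_ring"
  then obtain S where "A \<in> bounded_qops" "S \<circ> A = id" "A \<circ> S = id"
    by (auto simp: Units_def)
  then show "A \<in> {A \<in> bounded_qops. bij A}" by (auto intro: o_bij)
next
  fix A :: "'a \<Rightarrow> 'a" assume "A \<in> {A \<in> bounded_qops. bij A}"
  then have A: "A \<in> bounded_qops" "bij A" by auto
  have "inv_into UNIV A \<circ> A = id" "A \<circ> inv_into UNIV A = id"
    using A(2) by (simp_all add: bij_is_inj bij_is_surj flip: surj_iff)
  then show "A \<in> Units qop_ring"
    using A qop_inverse[OF A] by (auto simp: Units_def)
qed

definition ess_inverse :: "('v::rquat_hilbert \<Rightarrow> 'v) \<Rightarrow> ('v \<Rightarrow> 'v) \<Rightarrow> bool" where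
  "ess_inverse A S \<longleftrightarrow> S \<in> bounded_qops \<and>
     (\<lambda>x. A (S x) - x) \<in> compact_qops \<and> (\<lambda>x. S (A x) - x) \<in> compact_qops"

text \<open>Cosets agree exactly when their representatives differ by a compact operator, so the two
  inverse laws in the quotient become the two compactness conditions of \<open>ess_inverse\<close>.
  From here on the Calkin algebra is handled through representatives.\<close>

lemma Units_calkin_iff:
  fixes A :: "'v::rquat_hilbert \<Rightarrow> 'v"
  assumes A: "A \<in> bounded_qops"
  shows "compact_qops +>\<^bsub>qop_ring\<^esub> A \<in> Units calkin \<longleftrightarrow> (\<exists>S. ess_inverse A S)"
proof -
  let ?R = "qop_ring :: ('v \<Rightarrow> 'v) ring"
  interpret ideal compact_qops ?R by (rule ideal_compact_qops)
  have coset_eq: "compact_qops +>\<^bsub>?R\<^esub> B = compact_qops +>\<^bsub>?R\<^esub> C \<longleftrightarrow> (\<lambda>x. B x - C x) \<in> compact_qops"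
    if "B \<in> bounded_qops" "C \<in> bounded_qops" for B C :: "'v \<Rightarrow> 'v"
    using quotient_eq_iff_same_a_r_cos[OF ideal_compact_qops, of B C] that
    by (simp add: a_minus_def a_inv_qop_ring)
  have carrier: "carrier (calkin :: ('v \<Rightarrow> 'v) set ring) = {compact_qops +>\<^bsub>?R\<^esub> B |B. B \<in> bounded_qops}"
    by (auto simp: calkin_def FactRing_def A_RCOSETS_def')
  have mult: "(compact_qops +>\<^bsub>?R\<^esub> B) \<otimes>\<^bsub>calkin\<^esub> (compact_qops +>\<^bsub>?R\<^esub> C) = compact_qops +>\<^bsub>?R\<^esub> (\<lambda>x. B (C x))"
    if "B \<in> bounded_qops" "C \<in> bounded_qops" for B C :: "'v \<Rightarrow> 'v"
    using rcoset_mult_add[of B C] that by (simp add: calkin_def FactRing_def o_def)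
  have one: "\<one>\<^bsub>calkin\<^esub> = compact_qops +>\<^bsub>?R\<^esub> (\<lambda>x. x)"
    by (simp add: calkin_def FactRing_def id_def)
  show ?thesis
  proof
    assume "compact_qops +>\<^bsub>qop_ring\<^esub> A \<in> Units calkin"
    then obtain S where "S \<in> bounded_qops"
      "(compact_qops +>\<^bsub>?R\<^esub> S) \<otimes>\<^bsub>calkin\<^esub> (compact_qops +>\<^bsub>?R\<^esub> A) = \<one>\<^bsub>calkin\<^esub>"
      "(compact_qops +>\<^bsub>?R\<^esub> A) \<otimes>\<^bsub>calkin\<^esub> (compact_qops +>\<^bsub>?R\<^esub> S) = \<one>\<^bsub>calkin\<^esub>"
      unfolding Units_def carrier by blast
    then show "\<exists>S. ess_inverse A S"
      using A by (auto simp: ess_inverse_def mult one coset_eq qop_comp qop_id)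
  next
    assume "\<exists>S. ess_inverse A S"
    then obtain S where S: "S \<in> bounded_qops" "(\<lambda>x. A (S x) - x) \<in> compact_qops"
      "(\<lambda>x. S (A x) - x) \<in> compact_qops" by (auto simp: ess_inverse_def)
    then have "(compact_qops +>\<^bsub>?R\<^esub> S) \<otimes>\<^bsub>calkin\<^esub> (compact_qops +>\<^bsub>?R\<^esub> A) = \<one>\<^bsub>calkin\<^esub>"
      "(compact_qops +>\<^bsub>?R\<^esub> A) \<otimes>\<^bsub>calkin\<^esub> (compact_qops +>\<^bsub>?R\<^esub> S) = \<one>\<^bsub>calkin\<^esub>"
      using A by (simp_all add: mult one coset_eq qop_comp qop_id)
    then show "compact_qops +>\<^bsub>qop_ring\<^esub> A \<in> Units calkin"
      unfolding Units_def carrier using A S(1) by blast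
  qed
qed

section \<open>Weyl operators\<close>

text \<open>The rank-nullity alternative for a finite-dimensional subspace of a possibly
  infinite-dimensional space. If \<open>h\<close> is injective but misses \<open>w\<close>, the
  image of a basis together with \<open>w\<close> has too many independent vectors; if
  \<open>h\<close> kills a nonzero \<open>x\<close>, a basis through \<open>x\<close> shows that too
  few vectors generate the image.\<close>

lemma linear_endo_finite_dim:
  fixes h :: "'a::real_vector \<Rightarrow> 'a"
  assumes h: "linear h" and W: "subspace W" "W \<subseteq> span B" "finite B" "h ` W \<subseteq> W"
  shows "inj_on h W \<longleftrightarrow> h ` W = W"
proof
  assume inj: "inj_on h W"
  obtain D where D: "D \<subseteq> W" "independent D" "W \<subseteq> span D"
    by (rule maximal_independent_subset)
  have spanD: "span D = W"
    using D W(1) by (simp add: span_minimal subset_antisym)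
  have fD: "finite D"
    using independent_span_bound[OF W(3) D(2)] D(1) W(2) by blast
  have indep: "independent (h ` D)"
    using D(2) inj h spanD by (simp add: linear_independent_injective_image)
  have im: "span (h ` D) = h ` W"
    using linear_span_image[OF h] spanD by blast
  show "h ` W = W"
  proof (rule ccontr)
    assume "h ` W \<noteq> W"
    then obtain w where w: "w \<in> W" "w \<notin> span (h ` D)" using W(4) im by blast
    then have "independent (insert w (h ` D))"
      using indep by (simp add: independent_insertI)
    moreover have "insert w (h ` D) \<subseteq> span D"
      using w W(4) D(1) spanD by auto
    ultimately have "card (insert w (h ` D)) \<le> card D"
      using independent_span_bound[OF fD] by blast
    moreover have "w \<notin> h ` D" using w(2) span_base[of w "h ` D"] by blast
    moreover have "card (h ` D) = card D"
      using inj D(1) by (meson card_image inj_on_subset)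
    ultimately show False using fD by simp
  qed
next
  assume surj: "h ` W = W"
  show "inj_on h W"
  proof (rule ccontr)
    assume "\<not> inj_on h W"
    then obtain u v where uv: "u \<in> W" "v \<in> W" "h u = h v" "u \<noteq> v"
      by (auto simp: inj_on_def)
    define x where "x = u - v"
    have x: "x \<in> W" "h x = 0" "x \<noteq> 0"
      using uv subspace_diff[OF W(1)] by (auto simp: x_def linear_diff[OF h])
    obtain D where D: "{x} \<subseteq> D" "D \<subseteq> W" "independent D" "W \<subseteq> span D"
      using maximal_independent_subset_extend[of "{x}" W] x by auto
    have spanD: "span D = W"
      using D W(1) by (simp add: span_minimal subset_antisym)
    have fD: "finite D"
      using independent_span_bound[OF W(3) D(3)] D(2) W(2) by blast
    have "h ` D \<subseteq> insert 0 (h ` (D - {x}))" using x by auto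
    then have "span (h ` D) \<subseteq> span (insert 0 (h ` (D - {x})))"
      by (rule span_mono)
    moreover have "span (h ` D) = W"
      using linear_span_image[OF h] spanD surj by metis
    ultimately have "D \<subseteq> span (h ` (D - {x}))"
      using D(2) by (simp add: span_insert_0)
    then have "card D \<le> card (h ` (D - {x}))"
      using independent_span_bound[OF finite_imageI[OF finite_Diff[OF fD]] D(3)] by simp
    also have "\<dots> \<le> card (D - {x})" using fD by (simp add: card_image_le)
    also have "\<dots> < card D" using fD D(1) by (intro card_Diff1_less) auto
    finally show False by simp
  qed
qed

definition weyl_op :: "('v::rquat_hilbert \<Rightarrow> 'v) \<Rightarrow> bool" where
  "weyl_op A \<longleftrightarrow> (\<exists>C K. C \<in> bounded_qops \<and> bij C \<and> K \<in> compact_qops \<and> A = (\<lambda>x. C x + K x))"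

lemma weyl_op_bounded: "weyl_op A \<Longrightarrow> A \<in> bounded_qops"
  by (auto simp: weyl_op_def qop_plus compact_qopsD)

lemma weyl_op_bij: "A \<in> bounded_qops \<Longrightarrow> bij A \<Longrightarrow> weyl_op A"
  unfolding weyl_op_def by (intro exI[of _ A] exI[of _ "\<lambda>x. 0"]) (simp add: compact_qop_zero)

lemma weyl_op_plus_compact:
  assumes "weyl_op A" "K \<in> compact_qops"
  shows "weyl_op (\<lambda>x. A x + K x)"
proof -
  obtain C L where "C \<in> bounded_qops" "bij C" "L \<in> compact_qops" "A = (\<lambda>x. C x + L x)"
    using assms(1) by (auto simp: weyl_op_def)
  then show ?thesis
    unfolding weyl_op_def using compact_qop_plus[OF _ assms(2), of L]
    by (intro exI[of _ C] exI[of _ "\<lambda>x. L x + K x"]) (simp add: add.assoc)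
qed

lemma bij_qop_inverse_bound:
  assumes "C \<in> bounded_qops" "bij C"
  obtains c where "c > 0" "\<And>x. norm x \<le> c * norm (C x)"
proof -
  obtain c where c: "c > 0" "\<And>x. norm (inv_into UNIV C x) \<le> c * norm x"
    using qop_bound[OF qop_inverse[OF assms]] by blast
  have "norm x \<le> c * norm (C x)" for x
    using c(2)[of "C x"] assms(2) by (simp add: bij_is_inj)
  then show thesis using c(1) that by blast
qed

text \<open>The compact part is kept and the difference \<open>B - A\<close> is absorbed into the
  bijective part; the radius \<open>1 / (2 * c)\<close> gives contraction factor 1/2.\<close>

lemma weyl_op_perturbation:
  assumes "weyl_op A"
  obtains e where "e > 0"
    "\<And>B. B \<in> bounded_qops \<Longrightarrow> (\<And>x. norm (B x - A x) \<le> e * norm x) \<Longrightarrow> weyl_op B"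
proof -
  obtain C K where C: "C \<in> bounded_qops" "bij C" and K: "K \<in> compact_qops" and A: "A = (\<lambda>x. C x + K x)"
    using assms by (auto simp: weyl_op_def)
  obtain c where c: "c > 0" "\<And>x. norm x \<le> c * norm (C x)"
    using bij_qop_inverse_bound[OF C] by blast
  have "weyl_op B" if B: "B \<in> bounded_qops" and BA: "\<And>x. norm (B x - A x) \<le> (1 / (2 * c)) * norm x" for B
  proof -
    have E: "(\<lambda>x. B x - A x) \<in> bounded_qops"
      using B weyl_op_bounded[OF assms] by (rule qop_sub)
    have "bij (\<lambda>x. C x + (B x - A x))"
      by (rule bij_perturbation[OF C c(2) E BA]) (use c(1) in auto)
    moreover have "(\<lambda>x. C x + (B x - A x)) \<in> bounded_qops"
      by (rule qop_plus[OF C(1) E])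
    ultimately have "weyl_op (\<lambda>x. (C x + (B x - A x)) + K x)"
      using weyl_op_plus_compact weyl_op_bij K by blast
    then show ?thesis by (simp add: A algebra_simps)
  qed
  then show thesis using that[of "1 / (2 * c)"] c(1) by simp
qed

text \<open>Split the compact part into a small operator and a finite-rank one. The small one leaves
  the bijective part bijective, and pulling the finite-rank one through the inverse of the new
  bijection \<open>C\<close> gives \<open>C\<close> after identity plus \<open>G\<close>. The real
  \<open>span\<close> in the conclusion suits the dimension counts that follow.\<close>

lemma weyl_op_finite_rank:
  assumes "weyl_op A"
  obtains C G B where "C \<in> bounded_qops" "bij C" "G \<in> bounded_qops" "finite B"
    "range G \<subseteq> span B" "A = (\<lambda>x. C (x + G x))"
proof -
  obtain C0 K where C0: "C0 \<in> bounded_qops" "bij C0" and K: "K \<in> compact_qops" and A: "A = (\<lambda>x. C0 x + K x)"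
    using assms by (auto simp: weyl_op_def)
  obtain c where c: "c > 0" "\<And>x. norm x \<le> c * norm (C0 x)"
    using bij_qop_inverse_bound[OF C0] by blast
  obtain F where F: "finite_rank F" "\<And>x. norm (K x - F x) \<le> (1 / (2 * c)) * norm x"
    using compact_qop_split[OF K, of "1 / (2 * c)"] c(1) by auto
  then obtain D where FB: "F \<in> bounded_qops" and D: "finite D" "range F \<subseteq> qspan D"
    by (auto simp: finite_rank_def)
  have E: "(\<lambda>x. K x - F x) \<in> bounded_qops"
    by (rule qop_sub[OF compact_qopsD[OF K] FB])
  define C where "C x = C0 x + (K x - F x)" for x
  have bij: "bij C"
    unfolding C_def[abs_def] by (rule bij_perturbation[OF C0 c(2) E F(2)]) (use c(1) in auto)
  have C: "C \<in> bounded_qops"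
    unfolding C_def[abs_def] by (rule qop_plus[OF C0(1) E])
  define G where "G x = inv_into UNIV C (F x)" for x
  have I: "inv_into UNIV C \<in> bounded_qops" by (rule qop_inverse[OF C bij])
  have G: "G \<in> bounded_qops"
    unfolding G_def[abs_def] by (rule qop_comp[OF I FB])
  have "range G \<subseteq> qspan (inv_into UNIV C ` D)"
  proof
    fix y assume "y \<in> range G"
    then obtain x where y: "y = inv_into UNIV C (F x)" by (auto simp: G_def)
    obtain k where "F x = (\<Sum>b\<in>D. b *\<^sub>Q k b)" using D(2) by (auto simp: qspan_iff image_subset_iff)
    then have "y = (\<Sum>b\<in>D. inv_into UNIV C b *\<^sub>Q k b)"
      by (simp add: y qop_sum[OF I] qop_scaleQ[OF I])
    then show "y \<in> qspan (inv_into UNIV C ` D)"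
      using D(1) by (auto intro!: qspan_sum qspan_scaleQ qspan_superset)
  qed
  moreover obtain B where "finite B" "qspan (inv_into UNIV C ` D) \<subseteq> span B"
    using qspan_subset_span[OF finite_imageI[OF D(1)]] by metis
  ultimately have B: "finite B" "range G \<subseteq> span B" by auto
  have "C (G x) = F x" for x
    using bij by (simp add: G_def bij_is_surj surj_f_inv_f)
  then have "A = (\<lambda>x. C (x + G x))"
    by (simp add: A qop_add[OF C]) (simp add: C_def)
  then show thesis using that C bij G B by blast
qed

lemma weyl_op_null_space_finite_dim:
  assumes "weyl_op A"
  obtains B where "finite B" "null_space A \<subseteq> span B"
proof -
  obtain C G B where C: "C \<in> bounded_qops" "bij C" and B: "finite B"
    "range G \<subseteq> span B" "A = (\<lambda>x. C (x + G x))"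
    using weyl_op_finite_rank[OF assms] by metis
  have "x \<in> span B" if "A x = 0" for x
  proof -
    have "C (x + G x) = C 0" using that by (simp add: B qop_zero[OF C(1)])
    then have "x = - G x" using C(2) by (metis bij_is_inj injD eq_neg_iff_add_eq_0)
    then show ?thesis using B(2) by (metis rangeI span_neg subsetD)
  qed
  then show thesis using that[OF B(1)] by (auto simp: null_space_def)
qed

text \<open>The Fredholm alternative. The map \<open>h\<close>, identity plus \<open>G\<close>,
  preserves \<open>span B\<close> and induces the identity on the quotient by it, so injectivity and
  surjectivity are both decided on this finite-dimensional space.\<close>

lemma weyl_op_inj_iff_surj:
  assumes "weyl_op A"
  shows "inj A \<longleftrightarrow> surj A"
proof -
  obtain C G B where C: "C \<in> bounded_qops" "bij C" and G: "G \<in> bounded_qops" and B: "finite B"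
    "range G \<subseteq> span B" and A: "A = (\<lambda>x. C (x + G x))"
    using weyl_op_finite_rank[OF assms] by metis
  define h where "h x = x + G x" for x
  have h: "h \<in> bounded_qops"
    unfolding h_def[abs_def] by (rule qop_plus[OF qop_id G])
  have lin: "linear h" using bounded_qops_linear[OF h] by (rule bounded_linear.linear)
  have hW: "h ` span B \<subseteq> span B"
    using B(2) by (auto simp: h_def intro: span_add)
  have A': "A = C \<circ> h" by (auto simp: A h_def)
  have "inj A \<longleftrightarrow> inj h"
    unfolding A' using C(2) by (metis bij_is_inj inj_compose inj_on_imageI2)
  also have "\<dots> \<longleftrightarrow> inj_on h (span B)"
  proof
    assume inj: "inj_on h (span B)"
    have "x = 0" if "h x = 0" for x
    proof -
      have "x = - G x" using that by (simp add: h_def eq_neg_iff_add_eq_0)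
      then have "x \<in> span B" using B(2) by (metis rangeI span_neg subsetD)
      then show ?thesis using inj that by (metis inj_onD qop_zero[OF h] span_zero)
    qed
    then show "inj h" using lin by (simp add: linear_injective_0)
  qed (rule inj_on_subset, auto)
  also have "\<dots> \<longleftrightarrow> h ` span B = span B"
    by (rule linear_endo_finite_dim[OF lin subspace_span subset_refl B(1) hW])
  also have "\<dots> \<longleftrightarrow> surj h"
  proof
    assume s: "h ` span B = span B"
    have "y \<in> range h" for y
    proof -
      have "- G y \<in> span B" using B(2) by (simp add: image_subset_iff span_neg)
      then obtain w where "h w = - G y" using s by (metis imageE)
      then have "h (y + w) = y" by (simp add: qop_add[OF h]) (simp add: h_def)
      then show ?thesis by (metis rangeI)
    qed
    then show "surj h" by blast
  next
    assume s: "surj h"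
    have "w \<in> h ` span B" if w: "w \<in> span B" for w
    proof -
      obtain x where x: "w = h x" using s by (metis surjD)
      then have "x = w - G x" by (simp add: h_def)
      then have "x \<in> span B" using B(2) w by (metis rangeI span_diff subsetD)
      then show ?thesis using x by blast
    qed
    then show "h ` span B = span B" using hW by blast
  qed
  also have "\<dots> \<longleftrightarrow> surj A"
  proof
    assume "surj A"
    then have "\<exists>x. C (h x) = C y" for y unfolding A' by (metis comp_apply surjD)
    then show "surj h" using C(2) by (metis bij_is_inj injD surjI)
  qed (simp add: A' comp_surj bij_is_surj C(2) del: comp_apply)
  finally show ?thesis .
qed

lemma weyl_op_comp_bij:
  assumes "weyl_op A" "C \<in> bounded_qops" "bij C"
  shows "weyl_op (\<lambda>x. A (C x))"
proof -
  obtain D K where "D \<in> bounded_qops" "bij D" "K \<in> compact_qops" "A = (\<lambda>x. D x + K x)"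
    using assms(1) by (auto simp: weyl_op_def)
  then show ?thesis
    unfolding weyl_op_def using assms
    by (intro exI[of _ "\<lambda>x. D (C x)"] exI[of _ "\<lambda>x. K (C x)"])
       (use bij_comp[of C D] in \<open>auto simp: qop_comp compact_qop_comp_right o_def\<close>)
qed

text \<open>
  If \<open>B = C + K\<close> is a Weyl operator close to \<open>A\<close>, then \<open>S B\<close> is bijective plus compact, so
  \<open>S = (S B - S K) C\<^sup>-\<^sup>1\<close> is Weyl, and so is its essential inverse \<open>A\<close>.
\<close>

lemma weyl_op_closed_in_ess_invertible:
  assumes A: "A \<in> bounded_qops" and S: "ess_inverse A S"
    and approx: "\<And>e. e > 0 \<Longrightarrow> \<exists>B. weyl_op B \<and> (\<forall>x. norm (B x - A x) \<le> e * norm x)"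
  shows "weyl_op A"
proof -
  have SB: "S \<in> bounded_qops" and SA: "(\<lambda>x. S (A x) - x) \<in> compact_qops"
    using S by (auto simp: ess_inverse_def)
  have weyl_S: "weyl_op S"
  proof -
    obtain s where s: "s > 0" "\<And>x. norm (S x) \<le> s * norm x"
      using qop_bound[OF SB] by blast
    obtain B where B: "weyl_op B" "\<And>x. norm (B x - A x) \<le> (1 / (2 * s)) * norm x"
      using approx[of "1 / (2 * s)"] s(1) by auto
    obtain C K where C: "C \<in> bounded_qops" "bij C" and K: "K \<in> compact_qops" and BCK: "B = (\<lambda>x. C x + K x)"
      using B(1) by (auto simp: weyl_op_def)
    have E: "(\<lambda>x. S (B x - A x)) \<in> bounded_qops"
      by (rule qop_comp[OF SB qop_sub[OF weyl_op_bounded[OF B(1)] A]])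
    have "bij (\<lambda>x. x + S (B x - A x))"
    proof (rule bij_perturbation[OF qop_id, where c = 1 and d = "1/2"])
      show "norm (S (B x - A x)) \<le> 1 / 2 * norm x" for x
        using s(2)[of "B x - A x"] mult_left_mono[OF B(2)[of x], of s] s(1) by simp
    qed (use E in \<open>auto simp: bij_id[unfolded id_def]\<close>)
    then have D: "weyl_op (\<lambda>x. x + S (B x - A x))"
      by (intro weyl_op_bij qop_plus[OF qop_id E])
    have "weyl_op (\<lambda>x. x + S (B x - A x) + ((S (A x) - x) - S (K x)))"
      by (rule weyl_op_plus_compact[OF D compact_qop_diff[OF SA compact_qop_comp_left[OF K SB]]])
    moreover have "x + S (B x - A x) + ((S (A x) - x) - S (K x)) = S (C x)" for x
      by (simp add: BCK qop_diff[OF SB] qop_add[OF SB])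
    ultimately have "weyl_op (\<lambda>x. S (C x))" by simp
    from weyl_op_comp_bij[OF this qop_inverse[OF C]] show ?thesis
      using C(2) by (simp add: bij_imp_bij_inv bij_is_surj surj_f_inv_f)
  qed
  then obtain E K where E: "E \<in> bounded_qops" "bij E" and K: "K \<in> compact_qops" and SEK: "S = (\<lambda>x. E x + K x)"
    by (auto simp: weyl_op_def)
  let ?I = "inv_into UNIV E"
  have I: "?I \<in> bounded_qops" by (rule qop_inverse[OF E])
  have "weyl_op ?I" using I E(2) by (simp add: weyl_op_bij bij_imp_bij_inv)
  \<comment> \<open>Since \<open>E (A x) = S (A x) - K (A x)\<close>, applying the inverse of
    \<open>E\<close> presents \<open>A\<close> as that inverse plus a compact operator.\<close>
  moreover have "(\<lambda>x. ?I ((S (A x) - x) - K (A x))) \<in> compact_qops"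
    by (rule compact_qop_comp_left[OF compact_qop_diff[OF SA compact_qop_comp_right[OF K A]] I])
  ultimately have "weyl_op (\<lambda>x. ?I x + ?I ((S (A x) - x) - K (A x)))"
    by (rule weyl_op_plus_compact)
  moreover have "?I x + ?I ((S (A x) - x) - K (A x)) = A x" for x
  proof -
    have "?I x + ?I ((S (A x) - x) - K (A x)) = ?I (E (A x))"
      by (simp add: qop_add[OF I, symmetric] SEK)
    then show ?thesis using E(2) by (simp add: bij_is_inj)
  qed
  ultimately show ?thesis by simp
qed

section \<open>Fredholm and semi-Fredholm operators\<close>

definition qsubspace :: "'v::rquat_vector set \<Rightarrow> bool" where
  "qsubspace W \<longleftrightarrow> 0 \<in> W \<and> (\<forall>x\<in>W. \<forall>y\<in>W. x + y \<in> W) \<and> (\<forall>x\<in>W. \<forall>q. x *\<^sub>Q q \<in> W)"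

definition qindep_mod :: "'v::rquat_vector set \<Rightarrow> 'v set \<Rightarrow> bool" where
  "qindep_mod W B \<longleftrightarrow> (\<forall>c. (\<Sum>b\<in>B. b *\<^sub>Q c b) \<in> W \<longrightarrow> (\<forall>b\<in>B. c b = 0))"

lemma qsubspace_zero: "qsubspace {0}"
  by (auto simp: qsubspace_def)

lemma qsubspace_range: "A \<in> bounded_qops \<Longrightarrow> qsubspace (range A)"
  unfolding qsubspace_def by (auto simp flip: qop_add qop_scaleQ) (metis qop_zero rangeI)

text \<open>The relation with nonzero coefficient at \<open>b0\<close> is multiplied on the right by
  \<open>inverse (c b0) * d b0\<close> and subtracted. The order of the factors is what makes the
  new coefficient at \<open>b0\<close> vanish.\<close>

lemma spanning_mod_remove:
  assumes W: "qsubspace W" and G: "finite G" "b0 \<in> G" "(\<Sum>b\<in>G. b *\<^sub>Q c b) \<in> W" "c b0 \<noteq> 0"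
    and u: "u - (\<Sum>b\<in>G. b *\<^sub>Q d b) \<in> W"
  shows "u - (\<Sum>b\<in>G - {b0}. b *\<^sub>Q (d b - c b * (inverse (c b0) * d b0))) \<in> W"
proof -
  have "(\<Sum>b\<in>G - {b0}. b *\<^sub>Q (d b - c b * (inverse (c b0) * d b0))) =
      (\<Sum>b\<in>G. b *\<^sub>Q (d b - c b * (inverse (c b0) * d b0)))"
    using G by (intro sum.mono_neutral_left) (auto simp flip: mult.assoc)
  also have "\<dots> = (\<Sum>b\<in>G. b *\<^sub>Q d b) - (\<Sum>b\<in>G. b *\<^sub>Q c b) *\<^sub>Q (inverse (c b0) * d b0)"
    by (simp add: scaleQ_diff_right sum_subtractf scaleQ_sum_left scaleQ_scaleQ)
  finally have eq: "u - (\<Sum>b\<in>G - {b0}. b *\<^sub>Q (d b - c b * (inverse (c b0) * d b0))) =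
      (u - (\<Sum>b\<in>G. b *\<^sub>Q d b)) + (\<Sum>b\<in>G. b *\<^sub>Q c b) *\<^sub>Q (inverse (c b0) * d b0)"
    by simp
  show ?thesis
    unfolding eq using W u G(3) unfolding qsubspace_def by blast
qed

text \<open>A generating set of least cardinality is independent modulo \<open>W\<close>, since a
  nontrivial relation would allow a generator to be removed.\<close>

lemma qbasis_mod_exists:
  assumes W: "qsubspace W" and G: "finite G" "G \<subseteq> U" "\<And>u. u \<in> U \<Longrightarrow> \<exists>c. u - (\<Sum>b\<in>G. b *\<^sub>Q c b) \<in> W"
  obtains B where "qbasis_mod U W B"
proof -
  define P where "P n \<longleftrightarrow> (\<exists>G. finite G \<and> G \<subseteq> U \<and> (\<forall>u\<in>U. \<exists>c. u - (\<Sum>b\<in>G. b *\<^sub>Q c b) \<in> W) \<and> card G = n)" for n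
  have "\<exists>n. P n" unfolding P_def using G by blast
  then obtain n where n: "P n" "\<And>m. m < n \<Longrightarrow> \<not> P m"
    using exists_least_iff[of P] by blast
  then obtain B where B: "finite B" "B \<subseteq> U" "\<And>u. u \<in> U \<Longrightarrow> \<exists>c. u - (\<Sum>b\<in>B. b *\<^sub>Q c b) \<in> W" "card B = n"
    unfolding P_def by blast
  have "c b = 0" if c: "(\<Sum>b\<in>B. b *\<^sub>Q c b) \<in> W" "b \<in> B" for c b
  proof (rule ccontr)
    assume "c b \<noteq> 0"
    have "\<exists>c. u - (\<Sum>b\<in>B - {b}. b *\<^sub>Q c b) \<in> W" if "u \<in> U" for u
    proof -
      obtain d where "u - (\<Sum>b\<in>B. b *\<^sub>Q d b) \<in> W" using B(3)[OF \<open>u \<in> U\<close>] ..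
      from spanning_mod_remove[OF W B(1) c(2) c(1) \<open>c b \<noteq> 0\<close> this] show ?thesis
        by (rule exI[where P = "\<lambda>c. u - (\<Sum>b\<in>B - {b}. b *\<^sub>Q c b) \<in> W"])
    qed
    then have "P (card (B - {b}))"
      unfolding P_def using B(1,2) by (intro exI[of _ "B - {b}"]) auto
    moreover have "card (B - {b}) < n" using B(1,4) c(2) by (metis card_Diff1_less)
    ultimately show False using n(2) by blast
  qed
  then have "qbasis_mod U W B"
    unfolding qbasis_mod_def using B by blast
  then show thesis using that by blast
qed

lemma qdim_quot_finite_iff: "qdim_quot U W < \<infinity> \<longleftrightarrow> (\<exists>B. qbasis_mod U W B)"
  unfolding qdim_quot_def INF_less_iff by auto

lemma qdim_quot_le: "qbasis_mod U W B \<Longrightarrow> qdim_quot U W \<le> enat (card B)"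
  unfolding qdim_quot_def by (rule INF_lower) simp

lemma qdim_quot_attained:
  assumes "qdim_quot U W < \<infinity>"
  obtains B where "qbasis_mod U W B" "qdim_quot U W = enat (card B)"
proof -
  let ?A = "(\<lambda>B. enat (card B)) ` {B. qbasis_mod U W B}"
  have "?A \<noteq> {}" using assms unfolding qdim_quot_finite_iff by blast
  then have "Inf ?A \<in> ?A" unfolding Inf_enat_def by (auto intro: LeastI)
  then show thesis using that unfolding qdim_quot_def by auto
qed

text \<open>An independent set smaller than the infimum of all basis cardinalities cannot be a
  basis, so some vector lies outside its span modulo \<open>W\<close> and can be adjoined. This
  relies on the definition as an infimum and avoids comparing two bases.\<close>

lemma qindep_mod_exists:
  assumes W: "qsubspace W" and j: "enat j \<le> qdim_quot UNIV W"
  shows "\<exists>G. finite G \<and> card G = j \<and> qindep_mod W G"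
  using j
proof (induction j)
  case 0
  then show ?case by (intro exI[of _ "{}"]) (simp add: qindep_mod_def)
next
  case (Suc j)
  then have "enat j < qdim_quot UNIV W"
    by (metis Suc_ile_eq)
  with Suc.IH obtain G where G: "finite G" "card G = j" "qindep_mod W G"
    by (auto dest: less_imp_le)
  have "\<not> qbasis_mod UNIV W G"
    using qdim_quot_le[of UNIV W G] G(2) \<open>enat j < qdim_quot UNIV W\<close> by auto
  then obtain u where u: "\<And>c. u - (\<Sum>b\<in>G. b *\<^sub>Q c b) \<notin> W"
    using G by (auto simp: qbasis_mod_def qindep_mod_def)
  have uG: "u \<notin> G"
  proof
    assume "u \<in> G"
    then have "(\<Sum>b\<in>G. b *\<^sub>Q (if b = u then 1 else 0)) = u"
      using G(1) by (simp add: if_distrib[of "(*\<^sub>Q) _"] scaleQ_one cong: if_cong)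
    then have "u - (\<Sum>b\<in>G. b *\<^sub>Q (if b = u then 1 else 0)) \<in> W"
      using W by (simp add: qsubspace_def)
    with u[of "\<lambda>b. if b = u then 1 else 0"] show False by contradiction
  qed
  have "qindep_mod W (insert u G)"
    unfolding qindep_mod_def
  proof (intro allI impI)
    fix c assume "(\<Sum>b\<in>insert u G. b *\<^sub>Q c b) \<in> W"
    then have c: "u *\<^sub>Q c u + (\<Sum>b\<in>G. b *\<^sub>Q c b) \<in> W"
      using G(1) uG by simp
    have "c u = 0"
    proof (rule ccontr)
      assume nz: "c u \<noteq> 0"
      have "(u *\<^sub>Q c u + (\<Sum>b\<in>G. b *\<^sub>Q c b)) *\<^sub>Q inverse (c u) \<in> W"
        using W c by (simp add: qsubspace_def)
      moreover have "(u *\<^sub>Q c u + (\<Sum>b\<in>G. b *\<^sub>Q c b)) *\<^sub>Q inverse (c u) =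
          u - (\<Sum>b\<in>G. b *\<^sub>Q (- (c b * inverse (c u))))"
        using nz by (simp add: scaleQ_add_left scaleQ_sum_left scaleQ_scaleQ scaleQ_one sum_negf)
      ultimately show False using u[of "\<lambda>b. - (c b * inverse (c u))"] by simp
    qed
    then show "\<forall>b\<in>insert u G. c b = 0"
      using c G(3) by (simp add: qindep_mod_def)
  qed
  then show ?case using G uG by (intro exI[of _ "insert u G"]) simp
qed

section \<open>Null spaces, closed ranges and lower bounds\<close>

lemma null_space_qspan:
  assumes A: "A \<in> bounded_qops" and fin: "qdim (null_space A) < \<infinity>"
  obtains E where "qorthonormal E" "null_space A = qspan E" "enat (card E) \<le> qdim (null_space A)"
proof -
  obtain B where B: "qbasis_mod (null_space A) {0} B" "qdim (null_space A) = enat (card B)"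
    using qdim_quot_attained fin unfolding qdim_def by blast
  then have "finite B" by (simp add: qbasis_mod_def)
  then obtain E where E: "qorthonormal E" "qspan E = qspan B" "card E \<le> card B"
    by (rule Gram_Schmidt)
  have "null_space A = qspan B"
  proof (intro equalityI subsetI)
    show "x \<in> qspan B" if "x \<in> null_space A" for x
      using that B(1) by (auto simp: qbasis_mod_def qspan_iff)
    show "x \<in> null_space A" if x: "x \<in> qspan B" for x
    proof -
      obtain c where "x = (\<Sum>b\<in>B. b *\<^sub>Q c b)" using x by (auto simp: qspan_iff)
      moreover have "A b = 0" if "b \<in> B" for b
        using B(1) that by (auto simp: qbasis_mod_def null_space_def)
      ultimately show ?thesis
        by (simp add: null_space_def qop_sum[OF A] qop_scaleQ[OF A])
    qed
  qed
  then show thesis using that E B(2) by simp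
qed

text \<open>The equation \<open>qproj E x = 0\<close> expresses orthogonality to the null space.
  This lemma and the next say that \<open>A\<close> maps the orthogonal complement of its null space
  bijectively onto its range.\<close>

lemma null_space_orthogonal_unique:
  assumes A: "A \<in> bounded_qops" and E: "qorthonormal E" "null_space A = qspan E"
    and "A x = A y" "qproj E x = 0" "qproj E y = 0"
  shows "x = y"
proof -
  have "x - y \<in> qspan E"
    unfolding E(2)[symmetric] using assms(4) by (simp add: null_space_def qop_diff[OF A])
  then have "x - y = qproj E (x - y)" by (simp add: qproj_fixes[OF E(1)])
  then show ?thesis using assms by (simp add: qop_diff[OF qproj_in_bounded_qops])
qed

lemma null_space_orthogonal_part:
  assumes A: "A \<in> bounded_qops" and E: "qorthonormal E" "null_space A = qspan E"
  shows "A (x - qproj E x) = A x" "qproj E (x - qproj E x) = 0"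
proof -
  have "A (qproj E x) = 0"
    using qproj_in_qspan[of E x] unfolding E(2)[symmetric] by (simp add: null_space_def)
  then show "A (x - qproj E x) = A x" by (simp add: qop_diff[OF A])
  show "qproj E (x - qproj E x) = 0"
    by (simp add: qop_diff[OF qproj_in_bounded_qops] qproj_fixes[OF E(1) qproj_in_qspan])
qed

text \<open>The inverse of \<open>A\<close> from its range to the orthogonal complement of the null
  space has a closed graph, and the range is a Banach space because it is closed;
  \<open>x - qproj E x\<close> is the value of this inverse at \<open>A x\<close>.\<close>

lemma closed_range_bound:
  assumes A: "A \<in> bounded_qops" and closed: "closed (range A)"
    and E: "qorthonormal E" "null_space A = qspan E"
  obtains C where "\<And>x. norm (x - qproj E x) \<le> C * norm (A x)"
proof -
  note unique = null_space_orthogonal_unique[OF A E] and part = null_space_orthogonal_part[OF A E]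
  define f where "f y = (SOME x. A x = y \<and> qproj E x = 0)" for y
  have f: "A (f y) = y" "qproj E (f y) = 0" if y: "y \<in> range A" for y
  proof -
    have "\<exists>x. A x = y \<and> qproj E x = 0" using y part by (metis rangeE)
    from someI_ex[OF this] show "A (f y) = y" "qproj E (f y) = 0" by (auto simp: f_def)
  qed
  have sub: "subspace (range A)"
    using linear_subspace_image[OF bounded_linear.linear[OF bounded_qops_linear[OF A]] subspace_UNIV] .
  obtain C where C: "\<And>y. y \<in> range A \<Longrightarrow> norm (f y) \<le> C * norm y"
  proof (rule closed_graph_on_subspace[of "range A" f, OF sub closed])
    show "f (x + y) = f x + f y" if "x \<in> range A" "y \<in> range A" for x y
      using that f subspace_add[OF sub]
      by (rule_tac unique) (simp_all add: qop_add[OF A] qop_add[OF qproj_in_bounded_qops])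
    show "f (r *\<^sub>R x) = r *\<^sub>R f x" if "x \<in> range A" for r x
      using that f subspace_scale[OF sub]
      by (rule_tac unique) (simp_all add: qop_scaleR[OF A] qop_scaleR[OF qproj_in_bounded_qops])
    show "f x = y" if s: "\<And>n. s n \<in> range A" "s \<longlonglongrightarrow> x" "(\<lambda>n. f (s n)) \<longlonglongrightarrow> y" for s x y
    proof (rule unique)
      have x: "x \<in> range A" using closed s closed_sequentially by blast
      have "(\<lambda>n. A (f (s n))) \<longlonglongrightarrow> A y" "(\<lambda>n. qproj E (f (s n))) \<longlonglongrightarrow> qproj E y"
        using bounded_linear.tendsto[OF bounded_qops_linear s(3)] A qproj_in_bounded_qops by blast+
      then have "s \<longlonglongrightarrow> A y" "(\<lambda>n. 0) \<longlonglongrightarrow> qproj E y"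
        using f s(1) by simp_all
      then show "A (f x) = A y" "qproj E y = 0"
        using f(1)[OF x] s(2) LIMSEQ_unique tendsto_const by metis+
      show "qproj E (f x) = 0" using f(2)[OF x] .
    qed
  qed blast
  have "f (A x) = x - qproj E x" for x
    using f[of "A x"] part[of x] by (rule_tac unique) auto
  then have "norm (x - qproj E x) \<le> C * norm (A x)" for x
    using C[of "A x"] by simp
  then show thesis using that by blast
qed

text \<open>Index at most zero leaves room to send an orthonormal basis of the null space to vectors
  independent modulo the range of \<open>A\<close>; this defines \<open>F\<close> and makes
  \<open>A + F\<close> injective. If no lower bound existed, unit vectors with images tending to 0
  would have a convergent subsequence, whose limit is a unit vector in the null space of
  \<open>A + F\<close>.\<close>

lemma left_fredholm_finite_rank_bounded_below:
  assumes A: "A \<in> left_fredholm" and ind: "fredholm_index A \<le> 0"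
  obtains F c where "finite_rank F" "c > 0" "\<And>x. norm x \<le> c * norm (A x + F x)"
proof -
  have AB: "A \<in> bounded_qops" and closed: "closed (range A)" and fin: "qdim (null_space A) < \<infinity>"
    using A by (auto simp: left_fredholm_def)
  obtain E where E: "qorthonormal E" "null_space A = qspan E" "enat (card E) \<le> qdim (null_space A)"
    using null_space_qspan[OF AB fin] by blast
  have finE: "finite E" using E(1) by (simp add: qorthonormal_def)
  have "qdim (null_space A) \<le> qdim_quot UNIV (range A)"
    using ind fin by (cases "qdim (null_space A)"; cases "qdim_quot UNIV (range A)")
      (auto simp: fredholm_index_def)
  then obtain G where G: "finite G" "card G = card E" "qindep_mod (range A) G"
    using qindep_mod_exists[OF qsubspace_range[OF AB]] E(3) by (meson order_trans)
  obtain g where g: "bij_betw g E G"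
    using finE G(1,2) by (metis finite_same_card_bij)
  define F where "F x = (\<Sum>e\<in>E. g e *\<^sub>Q qinner e x)" for x
  have FB: "F \<in> bounded_qops"
    unfolding F_def[abs_def] using qop_rank_one[of _ 1] by (intro qop_sum_ops) simp
  have gG: "g e \<in> G" if "e \<in> E" for e using g that by (auto simp: bij_betw_def)
  have FG: "range F \<subseteq> qspan G"
    using gG G(1) by (auto simp: F_def intro!: qspan_sum qspan_scaleQ qspan_superset)
  have F: "finite_rank F"
    unfolding finite_rank_def using FB FG G(1) by blast
  \<comment> \<open>\<open>F x\<close> is minus \<open>A x\<close>, so a combination of
    \<open>G\<close> lies in the range; independence modulo the range kills every
    coefficient.\<close>
  have F_zero: "qproj E x = 0 \<and> A x = 0" if "A x + F x = 0" for x
  proof -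
    define h where "h = inv_into E g"
    have gh: "g (h b) = b" "h (g e) = e" if "b \<in> G" "e \<in> E" for b e
      using g that by (auto simp: h_def bij_betw_def f_inv_into_f)
    have "F x = (\<Sum>b\<in>G. b *\<^sub>Q qinner (h b) x)"
      unfolding F_def using gh(2)[OF gG] by (simp add: sum.reindex_bij_betw[OF g, symmetric])
    moreover have "F x = A (- x)"
      using that by (simp add: qop_minus[OF AB] eq_neg_iff_add_eq_0 add.commute)
    ultimately have "(\<Sum>b\<in>G. b *\<^sub>Q qinner (h b) x) \<in> range A" by (metis rangeI)
    then have "\<forall>b\<in>G. qinner (h b) x = 0"
      using G(3)[unfolded qindep_mod_def, rule_format, of "\<lambda>b. qinner (h b) x"] by simp
    then have "qinner e x = 0" if "e \<in> E" for e
      using gh(2)[OF gG[OF that] that] gG[OF that] by metis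
    then show ?thesis using that by (simp add: F_def qproj_def)
  qed
  have inj: "x = 0" if "A x + F x = 0" for x
  proof -
    have "x \<in> qspan E" using F_zero[OF that] unfolding E(2)[symmetric] by (simp add: null_space_def)
    then show ?thesis using F_zero[OF that] qproj_fixes[OF E(1)] by auto
  qed
  obtain C where C: "\<And>x. norm (x - qproj E x) \<le> C * norm (A x)"
    using closed_range_bound[OF AB closed E(1,2)] by blast
  have "\<exists>c>0. \<forall>x. norm x \<le> c * norm (A x + F x)"
  proof (rule ccontr)
    assume neg: "\<not> ?thesis"
    have "\<exists>x. norm x = 1 \<and> norm (A x + F x) < 1 / real (Suc n)" for n
    proof -
      obtain x where x: "norm x > real (Suc n) * norm (A x + F x)"
        using neg by (metis not_le of_nat_0_less_iff zero_less_Suc)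
      then have x0: "norm x > 0" by (smt (verit) mult_nonneg_nonneg norm_ge_zero of_nat_0_le_iff)
      let ?u = "x /\<^sub>R norm x"
      have "A ?u + F ?u = (A x + F x) /\<^sub>R norm x"
        by (simp add: qop_scaleR[OF AB] qop_scaleR[OF FB] scaleR_add_right)
      then have "norm (A ?u + F ?u) = norm (A x + F x) / norm x"
        by (simp add: divide_inverse mult.commute)
      also have "\<dots> < 1 / real (Suc n)"
        using x x0 by (simp add: field_simps)
      finally show ?thesis using x0 by (intro exI[of _ ?u]) simp
    qed
    then obtain x where x: "\<And>n. norm (x n) = 1" "\<And>n. norm (A (x n) + F (x n)) < 1 / real (Suc n)"
      by metis
    have lim0: "(\<lambda>n. A (x n) + F (x n)) \<longlonglongrightarrow> 0"
      by (rule LIMSEQ_norm_0) (use x(2) in auto)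
    have bx: "bounded (range x)" using x(1) by (auto simp: bounded_iff)
    \<comment> \<open>Two extractions are needed: convergence of \<open>F\<close> along the sequence
      gives that of \<open>A\<close>, hence of the component orthogonal to the null space, while the
      component inside the null space converges by compactness of \<open>qproj E\<close>.\<close>
    obtain y r where r: "strict_mono r" "(\<lambda>n. F (x (r n))) \<longlonglongrightarrow> y"
      using compact_qop_subsequence[OF finite_rank_compact[OF F] bx] by metis
    have bxr: "bounded (range (\<lambda>n. x (r n)))" using x(1) by (auto simp: bounded_iff)
    obtain p r' where r': "strict_mono r'" "(\<lambda>n. qproj E (x (r (r' n)))) \<longlonglongrightarrow> p"
      using compact_qop_subsequence[OF compact_qproj bxr] by metis
    define z where "z n = x (r (r' n))" for n
    have zF: "(\<lambda>n. F (z n)) \<longlonglongrightarrow> y"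
      using LIMSEQ_subseq_LIMSEQ[OF r(2) r'(1)] by (simp add: o_def z_def)
    have zAF: "(\<lambda>n. A (z n) + F (z n)) \<longlonglongrightarrow> 0"
      using LIMSEQ_subseq_LIMSEQ[OF LIMSEQ_subseq_LIMSEQ[OF lim0 r(1)] r'(1)] by (simp add: o_def z_def)
    have zA: "(\<lambda>n. A (z n)) \<longlonglongrightarrow> - y"
      using tendsto_diff[OF zAF zF] by simp
    have "- y \<in> range A"
      using closed_sequentially[OF closed _ zA] by blast
    then obtain a where a: "A a = - y" by (metis imageE)
    have "(\<lambda>n. C * norm (A (z n) - A a)) \<longlonglongrightarrow> 0"
      using tendsto_mult_right_zero[OF tendsto_norm_zero[OF LIM_zero[OF zA]]] by (simp add: a)
    then have "(\<lambda>n. (z n - a) - qproj E (z n - a)) \<longlonglongrightarrow> 0"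
      by (rule Lim_null_comparison[rotated])
         (use C in \<open>simp add: qop_diff[OF AB, symmetric]\<close>)
    from tendsto_add[OF this tendsto_add[OF r'(2) tendsto_const[of "a - qproj E a"]]]
    have "z \<longlonglongrightarrow> p + (a - qproj E a)"
      by (simp add: qop_diff[OF qproj_in_bounded_qops] z_def[abs_def])
    then obtain l where l: "z \<longlonglongrightarrow> l" by blast
    have "(\<lambda>n. A (z n) + F (z n)) \<longlonglongrightarrow> A l + F l"
      using bounded_linear.tendsto[OF bounded_qops_linear[OF AB] l]
        bounded_linear.tendsto[OF bounded_qops_linear[OF FB] l] by (rule tendsto_add)
    then have "A l + F l = 0" using zAF LIMSEQ_unique by blast
    then have "l = 0" by (rule inj)
    moreover have "(\<lambda>n. norm (z n)) \<longlonglongrightarrow> norm l" by (rule tendsto_norm[OF l])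
    then have "norm l = 1" using x(1) by (simp add: z_def LIMSEQ_const_iff)
    ultimately show False by simp
  qed
  then show thesis using that F by blast
qed

lemma weyl_op_limit:
  assumes A: "A \<in> left_fredholm" and ind: "fredholm_index A \<le> 0"
    and approx: "\<And>e. e > 0 \<Longrightarrow> \<exists>B. weyl_op B \<and> (\<forall>x. norm (B x - A x) \<le> e * norm x)"
  shows "weyl_op A"
proof -
  have AB: "A \<in> bounded_qops" using A by (simp add: left_fredholm_def)
  obtain F c where F: "finite_rank F" and c: "c > 0" "\<And>x. norm x \<le> c * norm (A x + F x)"
    using left_fredholm_finite_rank_bounded_below[OF A ind] by blast
  have FK: "F \<in> compact_qops" by (rule finite_rank_compact[OF F])
  \<comment> \<open>The tolerance \<open>1 / (4 * c)\<close> serves twice: it leaves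
    \<open>?D\<close> bounded below with constant \<open>2 * c\<close>, and its product with
    \<open>2 * c\<close> is 1/2, so that the bijectivity of \<open>?D\<close> passes to
    \<open>A + F\<close>.\<close>
  obtain B where B: "weyl_op B" "\<And>x. norm (B x - A x) \<le> (1 / (4 * c)) * norm x"
    using approx[of "1 / (4 * c)"] c(1) by auto
  let ?D = "\<lambda>x. B x + F x"
  have D: "weyl_op ?D" by (rule weyl_op_plus_compact[OF B(1) FK])
  have low: "norm x \<le> (2 * c) * norm (?D x)" for x
  proof -
    have "norm (A x + F x) \<le> norm (?D x) + norm (B x - A x)"
      using norm_triangle_ineq4[of "?D x" "B x - A x"] by (simp add: algebra_simps)
    then have "c * norm (A x + F x) \<le> c * norm (?D x) + c * norm (B x - A x)"
      using c(1) by (simp flip: distrib_left)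
    moreover have "c * norm (B x - A x) \<le> norm x / 4"
      using mult_left_mono[OF B(2)[of x], of c] c(1) by simp
    ultimately have "norm x \<le> c * norm (?D x) + norm x / 4" using c(2)[of x] by linarith
    moreover have "0 \<le> c * norm (?D x)" using c(1) by simp
    ultimately have "norm x \<le> 2 * (c * norm (?D x))" using norm_ge_zero[of x] by linarith
    then show ?thesis by (simp only: mult.assoc)
  qed
  have DB: "?D \<in> bounded_qops" by (rule weyl_op_bounded[OF D])
  have "inj ?D"
  proof (rule injI)
    fix u v assume "B u + F u = B v + F v"
    then have "?D (u - v) = 0" using qop_diff[OF DB, of u v] by simp
    then show "u = v" using low[of "u - v"] by simp
  qed
  then have bij: "bij ?D" using weyl_op_inj_iff_surj[OF D] by (simp add: bij_def)
  have E: "(\<lambda>x. A x - B x) \<in> bounded_qops" by (rule qop_sub[OF AB weyl_op_bounded[OF B(1)]])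
  have "bij (\<lambda>x. ?D x + (A x - B x))"
    by (rule bij_perturbation[OF DB bij low E, of "1 / (4 * c)"])
       (use B(2) c(1) in \<open>auto simp: norm_minus_commute\<close>)
  then have "weyl_op (\<lambda>x. ?D x + (A x - B x))"
    by (intro weyl_op_bij qop_plus[OF DB E])
  from weyl_op_plus_compact[OF this compact_qop_uminus[OF FK]] show ?thesis by simp
qed

text \<open>\<open>S y\<close> is the unique \<open>x\<close> orthogonal to the null space for which
  \<open>y - A x\<close> lies in the algebraic complement \<open>qspan G\<close> of the range. The
  definition of \<open>fredholm\<close> does not demand a closed range; the graph of
  \<open>S\<close> is closed because the finite-dimensional space \<open>qspan G\<close> is. The two
  defects of \<open>S\<close> are then a finite-rank operator and minus the projection onto the null
  space.\<close>

lemma fredholm_ess_inverse: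
  assumes "A \<in> fredholm"
  obtains S where "ess_inverse A S"
proof -
  have A: "A \<in> bounded_qops" and fin: "qdim (null_space A) < \<infinity>" "qdim_quot UNIV (range A) < \<infinity>"
    using assms by (auto simp: fredholm_def)
  obtain E where E: "qorthonormal E" "null_space A = qspan E"
    using null_space_qspan[OF A fin(1)] by blast
  obtain G where "qbasis_mod UNIV (range A) G" using fin(2) unfolding qdim_quot_finite_iff by blast
  then have G: "finite G" "\<And>c. (\<Sum>b\<in>G. b *\<^sub>Q c b) \<in> range A \<Longrightarrow> \<forall>b\<in>G. c b = 0"
    "\<And>u. \<exists>c. u - (\<Sum>b\<in>G. b *\<^sub>Q c b) \<in> range A"
    by (auto simp: qbasis_mod_def)
  note part = null_space_orthogonal_part[OF A E]
  have G0: "d = 0" if d: "d \<in> qspan G" "d \<in> range A" for d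
  proof -
    obtain c where c: "d = (\<Sum>b\<in>G. b *\<^sub>Q c b)" using d(1) by (auto simp: qspan_iff)
    then have "\<forall>b\<in>G. c b = 0" using G(2) d(2) by simp
    then show ?thesis by (simp add: c)
  qed
  define P where "P y x \<longleftrightarrow> qproj E x = 0 \<and> y - A x \<in> qspan G" for y x
  have unique: "x = x'" if "P y x" "P y x'" for x x' y
  proof (rule null_space_orthogonal_unique[OF A E])
    have "y - A x' \<in> qspan G" "y - A x \<in> qspan G" using that by (simp_all add: P_def)
    then have "(y - A x') - (y - A x) \<in> qspan G" by (rule qspan_diff)
    moreover have "(y - A x') - (y - A x) = A (x - x')" by (simp add: qop_diff[OF A])
    ultimately have "A (x - x') = 0" using G0 by simp
    then show "A x = A x'" by (simp add: qop_diff[OF A])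
  qed (use that in \<open>auto simp: P_def\<close>)
  have exist: "\<exists>x. P y x" for y
  proof -
    obtain c x where "y - (\<Sum>b\<in>G. b *\<^sub>Q c b) = A x" using G(3)[of y] by blast
    then have "y - A (x - qproj E x) = (\<Sum>b\<in>G. b *\<^sub>Q c b)"
      unfolding part(1) by (simp add: algebra_simps)
    then have "P y (x - qproj E x)" using part(2) by (auto simp: P_def qspan_iff)
    then show ?thesis ..
  qed
  then obtain S where S: "\<And>y. P y (S y)" by metis
  have SI: "S y = x" if "P y x" for x y using unique[OF S that] .
  have add: "S (x + y) = S x + S y" for x y
  proof (rule SI)
    have "(x + y) - A (S x + S y) = (x - A (S x)) + (y - A (S y))" by (simp add: qop_add[OF A])
    moreover have "(x - A (S x)) + (y - A (S y)) \<in> qspan G"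
      using S[of x] S[of y] unfolding P_def by (blast intro: qspan_add)
    ultimately show "P (x + y) (S x + S y)"
      using S[of x] S[of y] unfolding P_def by (simp only: qop_add[OF qproj_in_bounded_qops] add_0)
  qed
  have scale: "S (x *\<^sub>Q q) = S x *\<^sub>Q q" for x q
  proof (rule SI)
    have "x *\<^sub>Q q - A (S x *\<^sub>Q q) = (x - A (S x)) *\<^sub>Q q" by (simp add: qop_scaleQ[OF A] scaleQ_diff_left)
    moreover have "(x - A (S x)) *\<^sub>Q q \<in> qspan G"
      using S[of x] unfolding P_def by (blast intro: qspan_scaleQ)
    ultimately show "P (x *\<^sub>Q q) (S x *\<^sub>Q q)"
      using S[of x] unfolding P_def by (simp only: qop_scaleQ[OF qproj_in_bounded_qops] scaleQ_zero_left)
  qed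
  obtain C where C: "\<And>y. y \<in> UNIV \<Longrightarrow> norm (S y) \<le> C * norm y"
  proof (rule closed_graph_on_subspace[of UNIV S])
    show "S (r *\<^sub>R x) = r *\<^sub>R S x" for r x by (simp add: scaleR_scaleQ scale)
    show "S x = y" if s: "s \<longlonglongrightarrow> x" "(\<lambda>n. S (s n)) \<longlonglongrightarrow> y" for s x y
    proof (rule SI)
      have "(\<lambda>n. s n - A (S (s n))) \<longlonglongrightarrow> x - A y"
        by (rule tendsto_diff[OF s(1) bounded_linear.tendsto[OF bounded_qops_linear[OF A] s(2)]])
      then have "x - A y \<in> qspan G"
        using closed_sequentially[OF closed_qspan[OF G(1)], of "\<lambda>n. s n - A (S (s n))"] S
        unfolding P_def by blast
      moreover have "(\<lambda>n. qproj E (S (s n))) \<longlonglongrightarrow> qproj E y"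
        by (rule bounded_linear.tendsto[OF bounded_qops_linear[OF qproj_in_bounded_qops] s(2)])
      then have "qproj E y = 0" using S by (simp add: P_def LIMSEQ_const_iff)
      ultimately show "P x y" by (simp add: P_def)
    qed
  qed (auto simp: add)
  then have SB: "S \<in> bounded_qops"
    by (intro bounded_qopsI[of _ C]) (auto simp: add scale)
  have D: "(\<lambda>x. A (S x) - x) \<in> bounded_qops" by (rule qop_sub[OF qop_comp[OF A SB] qop_id])
  have "A (S x) - x \<in> qspan G" for x
    using qspan_minus[of "x - A (S x)" G] S[of x] by (simp add: P_def)
  then have "finite_rank (\<lambda>x. A (S x) - x)"
    unfolding finite_rank_def using D G(1) by blast
  then have 1: "(\<lambda>x. A (S x) - x) \<in> compact_qops" by (rule finite_rank_compact)
  have "S (A x) - x = - qproj E x" for x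
  proof -
    have "P (A x) (x - qproj E x)" using part by (simp add: P_def qspan_zero)
    then show ?thesis using SI by simp
  qed
  then have "(\<lambda>x. S (A x) - x) \<in> compact_qops" using compact_qop_uminus[OF compact_qproj] by simp
  with 1 SB show thesis using that by (auto simp: ess_inverse_def)
qed

text \<open>Up to vectors in the image of \<open>span B\<close> under \<open>C\<close>, the operator
  \<open>A\<close> agrees with the surjective \<open>C\<close>.\<close>

lemma weyl_op_range_finite_codim:
  assumes "weyl_op A"
  obtains D where "finite D" "\<And>y. \<exists>d\<in>qspan D. y - d \<in> range A"
proof -
  obtain C G B where C: "C \<in> bounded_qops" "bij C" and B: "finite B"
    "range G \<subseteq> span B" and A: "A = (\<lambda>x. C (x + G x))"
    using weyl_op_finite_rank[OF assms] by metis
  have lin: "linear C" using bounded_qops_linear[OF C(1)] by (rule bounded_linear.linear)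
  have "span (C ` B) \<subseteq> qspan (C ` B)"
    using B(1) by (intro span_minimal subspace_qspan) (auto intro: qspan_superset)
  then have "C x \<in> qspan (C ` B)" if "x \<in> span B" for x
    using that linear_span_image[OF lin, of B] by blast
  then have "- C (G z) \<in> qspan (C ` B)" for z using B(2) by (simp add: image_subset_iff qspan_minus)
  moreover have "C z - (- C (G z)) \<in> range A" for z
    unfolding A by (auto simp: qop_add[OF C(1)])
  ultimately have "\<exists>d\<in>qspan (C ` B). y - d \<in> range A" for y
    using C(2) by (metis bij_is_surj surjD)
  then show thesis using that[of "C ` B"] B(1) by blast
qed

text \<open>Both products of \<open>A\<close> and \<open>S\<close> are identity plus compact, hence
  Weyl. The null space of \<open>A\<close> is contained in that of \<open>S A\<close>, and the range
  of \<open>A\<close> contains that of \<open>A S\<close>, so both defects are finite.\<close>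

lemma ess_inverse_fredholm:
  assumes A: "A \<in> bounded_qops" and S: "ess_inverse A S"
  shows "A \<in> fredholm"
proof -
  have weyl_id: "weyl_op (\<lambda>x. x)"
    using weyl_op_bij[OF qop_id] by (simp add: bij_id[unfolded id_def])
  have "weyl_op (\<lambda>x. x + (S (A x) - x))"
    by (rule weyl_op_plus_compact[OF weyl_id]) (use S in \<open>simp add: ess_inverse_def\<close>)
  then obtain B where "finite B" "null_space (\<lambda>x. x + (S (A x) - x)) \<subseteq> span B"
    by (rule weyl_op_null_space_finite_dim)
  moreover have "null_space A \<subseteq> null_space (\<lambda>x. x + (S (A x) - x))"
    using S by (auto simp: null_space_def ess_inverse_def qop_zero)
  ultimately obtain N where N: "finite N" "N \<subseteq> null_space A" "null_space A \<subseteq> qspan N"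
    using subset_span_imp_qspan by (metis order_trans)
  have "\<exists>c. u - (\<Sum>b\<in>N. b *\<^sub>Q c b) \<in> {0}" if "u \<in> null_space A" for u
    using N(3) that by (auto simp: qspan_iff)
  then obtain B1 where "qbasis_mod (null_space A) {0} B1"
    using qbasis_mod_exists[OF qsubspace_zero N(1,2)] by blast
  moreover have "weyl_op (\<lambda>x. x + (A (S x) - x))"
    by (rule weyl_op_plus_compact[OF weyl_id]) (use S in \<open>simp add: ess_inverse_def\<close>)
  then obtain D where D: "finite D" "\<And>y. \<exists>d\<in>qspan D. y - d \<in> range (\<lambda>x. x + (A (S x) - x))"
    by (rule weyl_op_range_finite_codim) (rule that)
  have "\<exists>c. u - (\<Sum>b\<in>D. b *\<^sub>Q c b) \<in> range A" for u
  proof -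
    obtain d where d: "d \<in> qspan D" "u - d \<in> range (\<lambda>x. x + (A (S x) - x))" using D(2) by blast
    then have "u - d \<in> range A" by auto
    then show ?thesis using d(1) by (auto simp: qspan_iff)
  qed
  then obtain B2 where "qbasis_mod UNIV (range A) B2"
    using qbasis_mod_exists[OF qsubspace_range[OF A] D(1), of UNIV] by blast
  ultimately show ?thesis
    unfolding fredholm_def qdim_def using A qdim_quot_finite_iff by blast
qed

section \<open>Making the quadratic operator invertible\<close>

lemma Q_op_plus_compact:
  assumes T: "T \<in> bounded_qops" and K: "K \<in> compact_qops"
  obtains L where "L \<in> compact_qops" "\<And>x. Q_op q (\<lambda>x. T x + K x) x = Q_op q T x + L x"
proof -
  define L where "L x = T (K x) + K (T x) + K (K x) - (2 * qRe q) *\<^sub>R K x" for x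
  have KB: "K \<in> bounded_qops" by (rule compact_qopsD[OF K])
  have "L \<in> compact_qops"
    unfolding L_def[abs_def]
    by (rule compact_qop_diff[OF compact_qop_plus[OF compact_qop_plus[OF compact_qop_comp_left[OF K T]
        compact_qop_comp_right[OF K T]] compact_qop_comp_right[OF K KB]] compact_qop_scaled[OF K]])
  moreover have "Q_op q (\<lambda>x. T x + K x) x = Q_op q T x + L x" for x
    by (simp add: Q_op_def L_def qop_add[OF T] qop_add[OF KB] algebra_simps)
  ultimately show thesis using that by blast
qed

lemma weyl_op_Q_op_plus_compact:
  assumes "T \<in> bounded_qops" "K \<in> compact_qops" "weyl_op (Q_op q T)"
  shows "weyl_op (Q_op q (\<lambda>x. T x + K x))"
proof -
  obtain L where "L \<in> compact_qops" "\<And>x. Q_op q (\<lambda>x. T x + K x) x = Q_op q T x + L x"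
    using Q_op_plus_compact[OF assms(1,2)] by metis
  then have "Q_op q (\<lambda>x. T x + K x) = (\<lambda>x. Q_op q T x + L x)" "L \<in> compact_qops" by auto
  then show ?thesis using weyl_op_plus_compact[OF assms(3)] by simp
qed

text \<open>
  The slice is a copy of \<open>\<complex>\<close> inside the quaternions. Right multiplication by elements of the slice
  makes the space complex, and for \<open>l\<close> in the slice the complex-linear operator
  \<open>T - l\<close> and its conjugate \<open>T - qcnj l\<close> are the two factors of \<open>Q_op l T\<close>.
\<close>

definition slice :: "quat set" where
  "slice = {q. qJ q = 0 \<and> qK q = 0}"

definition shift_op :: "quat \<Rightarrow> ('v::rquat_hilbert \<Rightarrow> 'v) \<Rightarrow> 'v \<Rightarrow> 'v" where
  "shift_op l T x = T x - x *\<^sub>Q l"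

abbreviation jq :: quat where "jq \<equiv> Quat 0 0 1 0"

lemma jq_square: "jq * jq = - 1"
  by (simp add: quat_eq_iff)

lemma slice_commute: "p \<in> slice \<Longrightarrow> q \<in> slice \<Longrightarrow> p * q = q * p"
  by (simp add: slice_def quat_eq_iff)

lemma slice_inverse: "p \<in> slice \<Longrightarrow> inverse p \<in> slice"
  by (simp add: slice_def inverse_quat_def)

lemma jq_slice: "l \<in> slice \<Longrightarrow> jq * qcnj l = l * jq"
  by (simp add: slice_def quat_eq_iff)

lemma slice_decomposition:
  obtains c d where "c \<in> slice" "d \<in> slice" "p = c + jq * d"
proof (rule that)
  \<comment> \<open>The minus sign in the second component comes from j i = - k.\<close>
  show "Quat (qRe p) (qI p) 0 0 \<in> slice" "Quat (qJ p) (- qK p) 0 0 \<in> slice"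
    by (simp_all add: slice_def)
  show "p = Quat (qRe p) (qI p) 0 0 + jq * Quat (qJ p) (- qK p) 0 0"
    by (simp add: quat_eq_iff)
qed

lemma shift_op_add: "T \<in> bounded_qops \<Longrightarrow> shift_op l T (x + y) = shift_op l T x + shift_op l T y"
  by (simp add: shift_op_def qop_add scaleQ_add_left)

lemma shift_op_scaleR: "T \<in> bounded_qops \<Longrightarrow> shift_op l T (r *\<^sub>R x) = r *\<^sub>R shift_op l T x"
  by (simp add: shift_op_def qop_scaleR scaleR_scaleQ_commute scaleR_diff_right)

lemma shift_op_slice:
  assumes "T \<in> bounded_qops" "l \<in> slice" "p \<in> slice"
  shows "shift_op l T (x *\<^sub>Q p) = shift_op l T x *\<^sub>Q p"
  using assms by (simp add: shift_op_def qop_scaleQ scaleQ_diff_left scaleQ_scaleQ slice_commute[of l p])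

text \<open>Right multiplication by j is bijective and conjugates the scalar \<open>l\<close>, so
  the two factors of \<open>Q_op l T\<close> are injective, or surjective, simultaneously.\<close>

lemma shift_op_jq:
  assumes "T \<in> bounded_qops" "l \<in> slice"
  shows "shift_op (qcnj l) T (x *\<^sub>Q jq) = shift_op l T x *\<^sub>Q jq"
  using assms by (simp add: shift_op_def qop_scaleQ scaleQ_diff_left scaleQ_scaleQ jq_slice)

text \<open>\<open>T\<close> commutes with right multiplications, and both the sum and the product
  of \<open>l\<close> and \<open>qcnj l\<close> are real, which gives the real coefficients of
  \<open>Q_op\<close>.\<close>

lemma shift_op_factor:
  assumes T: "T \<in> bounded_qops"
  shows "shift_op l T (shift_op (qcnj l) T x) = Q_op l T x"
    and "shift_op (qcnj l) T (shift_op l T x) = Q_op l T x"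
proof -
  have sum: "y *\<^sub>Q qcnj l + y *\<^sub>Q l = (2 * qRe l) *\<^sub>R y" for y :: 'a
  proof -
    have "qcnj l + l = of_real (2 * qRe l)" unfolding quat_eq_iff of_real_quat_sel by simp
    then show ?thesis by (simp only: scaleR_scaleQ scaleQ_add_right[symmetric])
  qed
  have prod: "x *\<^sub>Q (qcnj l * l) = (norm l)\<^sup>2 *\<^sub>R x" "x *\<^sub>Q (l * qcnj l) = (norm l)\<^sup>2 *\<^sub>R x"
    by (simp_all only: scaleR_scaleQ qcnj_mult_self)
  show "shift_op l T (shift_op (qcnj l) T x) = Q_op l T x"
    using sum[of "T x"] prod
    by (simp add: shift_op_def Q_op_def qop_diff[OF T] qop_scaleQ[OF T] scaleQ_diff_left scaleQ_scaleQ algebra_simps)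
  show "shift_op (qcnj l) T (shift_op l T x) = Q_op l T x"
    using sum[of "T x"] prod
    by (simp add: shift_op_def Q_op_def qop_diff[OF T] qop_scaleQ[OF T] scaleQ_diff_left scaleQ_scaleQ algebra_simps)
qed

text \<open>The image of a basis of \<open>U\<close> together with \<open>e\<close> is independent
  in \<open>W\<close>. The finite span around \<open>W\<close> matters because \<open>dim\<close> is
  0 on infinite-dimensional spaces.\<close>

lemma dim_less:
  fixes g :: "'a::real_vector \<Rightarrow> 'b::real_vector"
  assumes g: "linear g" "inj_on g U" "g ` U \<subseteq> W" and U: "subspace U"
    and W: "W \<subseteq> span B" "finite B" and e: "e \<in> W" "e \<notin> g ` U"
  shows "dim U < dim W"
proof -
  obtain D where D: "D \<subseteq> U" "independent D" "U \<subseteq> span D" "card D = dim U"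
    by (rule basis_exists)
  have spanD: "span D = U" using D U by (simp add: span_minimal subset_antisym)
  obtain D' where D': "D' \<subseteq> W" "independent D'" "W \<subseteq> span D'" "card D' = dim W"
    by (rule basis_exists)
  have fD': "finite D'" using independent_span_bound[OF W(2) D'(2)] D'(1) W(1) by blast
  have "independent (g ` D)"
    using D(2) g(1,2) spanD by (simp add: linear_independent_injective_image)
  moreover have "e \<notin> span (g ` D)" using e(2) linear_span_image[OF g(1)] spanD by blast
  ultimately have "independent (insert e (g ` D))" by (simp add: independent_insertI)
  moreover have "insert e (g ` D) \<subseteq> span D'" using e(1) D(1) g(3) D'(3) by blast
  ultimately have *: "finite (insert e (g ` D)) \<and> card (insert e (g ` D)) \<le> card D'"
    by (rule independent_span_bound[OF fD'])
  have "e \<notin> g ` D" using e(2) D(1) by blast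
  moreover have "card (g ` D) = card D" using g(2) D(1) by (meson card_image inj_on_subset)
  ultimately show ?thesis using conjunct1[OF *] conjunct2[OF *] D(4) D'(4) by simp
qed

text \<open>Write \<open>A\<close> for \<open>shift_op l T\<close>, and take a unit vector
  \<open>e\<close> in its null space and an \<open>f\<close> outside its range. If no nonzero
  multiple of \<open>f\<close> lies in the range, adding \<open>f *\<^sub>Q qinner e x\<close>
  leaves only those null vectors that are orthogonal to \<open>e\<close>. Otherwise some nonzero
  multiple \<open>f1\<close> equals \<open>A g\<close>, and exactly the slice multiples of
  \<open>f1\<close> lie in the range. The new null vectors are then carried injectively into the
  null space of \<open>A\<close> by \<open>\<phi>\<close>, which corrects by a multiple of
  \<open>g\<close>; the scalar \<open>s\<close> is tuned so that \<open>\<phi>\<close> misses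
  \<open>e\<close>.\<close>

lemma rank_one_reduces_null_space:
  assumes T: "T \<in> bounded_qops" and l: "l \<in> slice" and weyl: "weyl_op (Q_op l T)"
    and nbij: "\<not> bij (Q_op l T)"
  obtains K where "K \<in> compact_qops"
    "dim (null_space (shift_op l (\<lambda>x. T x + K x))) < dim (null_space (shift_op l T))"
proof -
  let ?A = "shift_op l T"
  have not_inj: "\<not> inj (Q_op l T)" and not_surj: "\<not> surj (Q_op l T)"
    using nbij weyl_op_inj_iff_surj[OF weyl] by (auto simp: bij_def)
  have QB: "Q_op l T \<in> bounded_qops" by (rule Q_op_in_bounded_qops[OF T])
  have conj: "shift_op (qcnj l) T x = ?A (x *\<^sub>Q (- jq)) *\<^sub>Q jq" for x
    using shift_op_jq[OF T l, of "x *\<^sub>Q (- jq)"]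
    by (simp only: scaleQ_scaleQ mult_minus_left jq_square minus_minus scaleQ_one)
  have A_zero: "?A 0 = 0" using shift_op_scaleR[OF T, of l 0 0] by simp
  have A_minus: "?A (- x) = - ?A x" for x using shift_op_scaleR[OF T, of l "- 1" x] by simp
  have jq_cancel: "x = 0" if "x *\<^sub>Q p = 0" "p \<noteq> 0" for x :: 'a and p
    using that norm_scaleQ[of x p] by simp
  \<comment> \<open>A null vector of \<open>Q_op l T\<close> is mapped by the conjugate factor to a
    null vector of \<open>?A\<close>; if it is mapped to 0, its multiple by \<open>- jq\<close> is a
    null vector of \<open>?A\<close> instead.\<close>
  obtain e where e: "?A e = 0" "norm e = 1"
  proof -
    obtain x where x: "x \<noteq> 0" "Q_op l T x = 0"
      using not_inj by (metis QB linear_injective_0 bounded_linear.linear bounded_qops_linear)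
    define y where "y = shift_op (qcnj l) T x"
    have y: "?A y = 0" using x shift_op_factor(1)[OF T, of l x] by (simp add: y_def)
    obtain z where z: "z \<noteq> 0" "?A z = 0"
    proof (cases "y = 0")
      case True
      then have "?A (x *\<^sub>Q (- jq)) *\<^sub>Q jq = 0" using conj[of x] by (simp add: y_def)
      then have "?A (x *\<^sub>Q (- jq)) = 0" by (rule jq_cancel) (simp add: quat_eq_iff)
      moreover have "x *\<^sub>Q (- jq) \<noteq> 0" using x(1) jq_cancel[of x "- jq"] by (auto simp: quat_eq_iff)
      ultimately show ?thesis using that by blast
    qed (use y that in blast)
    then show ?thesis
      using that[of "z /\<^sub>R norm z"] by (simp add: shift_op_scaleR[OF T])
  qed
  have ee: "qinner e e = 1" using e(2) by (simp add: qinner_self)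
  \<comment> \<open>If \<open>?A\<close> were onto, so would be the conjugate factor, through right
    multiplication by j, and hence the product \<open>Q_op l T\<close>.\<close>
  obtain f where f: "f \<notin> range ?A"
  proof (rule ccontr)
    assume "\<not> thesis"
    then have surj: "\<exists>x. y = ?A x" for y using that by blast
    have "\<exists>x. y = Q_op l T x" for y
    proof -
      obtain u where u: "y = ?A u" using surj by blast
      obtain v where v: "u *\<^sub>Q (- jq) = ?A v" using surj by blast
      have "shift_op (qcnj l) T (v *\<^sub>Q jq) = u"
        unfolding shift_op_jq[OF T l] v[symmetric]
        by (simp only: scaleQ_scaleQ mult_minus_left jq_square minus_minus scaleQ_one)
      then have "Q_op l T (v *\<^sub>Q jq) = y" using shift_op_factor(1)[OF T] u by metis
      then show ?thesis by metis
    qed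
    then show False using not_surj by (metis surjI)
  qed
  obtain B where B: "finite B" "null_space (Q_op l T) \<subseteq> span B"
    using weyl_op_null_space_finite_dim[OF weyl] by blast
  have "null_space ?A \<subseteq> null_space (Q_op l T)"
  proof
    fix x assume "x \<in> null_space ?A"
    then have "Q_op l T x = shift_op (qcnj l) T 0"
      using shift_op_factor(2)[OF T, of l x] by (simp add: null_space_def)
    then show "x \<in> null_space (Q_op l T)"
      by (simp add: null_space_def shift_op_def qop_zero[OF T])
  qed
  then have NB: "null_space ?A \<subseteq> span B" using B by blast
  have eN: "e \<in> null_space ?A" using e by (simp add: null_space_def)
  have sub: "subspace (null_space (shift_op l (\<lambda>x. T x + K x)))" if "K \<in> bounded_qops" for K
  proof -
    let ?S = "shift_op l (\<lambda>x. T x + K x)"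
    have "?S 0 = 0" by (simp add: shift_op_def qop_zero[OF T] qop_zero[OF that])
    then show ?thesis
      unfolding subspace_def null_space_def mem_Collect_eq
      using shift_op_add[OF qop_plus[OF T that]] shift_op_scaleR[OF qop_plus[OF T that]] by simp
  qed
  have shift_plus: "shift_op l (\<lambda>x. T x + K x) x = ?A x + K x" for K x
    by (simp add: shift_op_def)
  have rank_one: "(\<lambda>x. b *\<^sub>Q (p * qinner e x)) \<in> compact_qops" for b p
  proof -

    have "finite_rank (\<lambda>x. b *\<^sub>Q (p * qinner e x))"
      unfolding finite_rank_def using qop_rank_one[of b p e]
      by (auto intro!: exI[of _ "{b}"] simp: qspan_iff)
    then show ?thesis by (rule finite_rank_compact)
  qed
  show thesis
  proof (cases "\<forall>w. f *\<^sub>Q w \<in> range ?A \<longrightarrow> w = 0")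
    case True
    define K where "K x = f *\<^sub>Q (1 * qinner e x)" for x
    have K: "K \<in> compact_qops" unfolding K_def[abs_def] by (rule rank_one)
    have N: "?A x = 0 \<and> qinner e x = 0" if "x \<in> null_space (shift_op l (\<lambda>x. T x + K x))" for x
    proof -
      have x: "?A x + f *\<^sub>Q qinner e x = 0"
        using that shift_plus[of K x] by (simp add: null_space_def K_def)
      then have "f *\<^sub>Q qinner e x = ?A (- x)" by (simp add: A_minus eq_neg_iff_add_eq_0 add.commute)
      then have "qinner e x = 0" using True by (metis rangeI)
      then show ?thesis using x by simp
    qed
    have "dim (null_space (shift_op l (\<lambda>x. T x + K x))) < dim (null_space ?A)"
    proof (rule dim_less[OF linear_id _ _ sub[OF compact_qopsD[OF K]] NB B(1) eN])
      show "e \<notin> id ` null_space (shift_op l (\<lambda>x. T x + K x))" using N[of e] ee by auto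
    qed (use N in \<open>auto simp: null_space_def\<close>)
    then show thesis using that K by blast
  next
    case False
    then obtain w g where w: "w \<noteq> 0" "f *\<^sub>Q w = ?A g" by blast
    define f1 where "f1 = f *\<^sub>Q w"
    have f1A: "?A (g *\<^sub>Q p) = f1 *\<^sub>Q p" if "p \<in> slice" for p
      using shift_op_slice[OF T l that] w by (simp add: f1_def)
    \<comment> \<open>With \<open>f1\<close> and \<open>f1 *\<^sub>Q jq\<close> both in the range,
      all quaternionic multiples of \<open>f1\<close> would be there, in particular
      \<open>f\<close>.\<close>
    have f1j: "f1 *\<^sub>Q jq \<noteq> ?A x" for x
    proof
      assume x: "f1 *\<^sub>Q jq = ?A x"
      obtain c d where cd: "c \<in> slice" "d \<in> slice" "inverse w = c + jq * d"
        by (rule slice_decomposition)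
      have "f = f1 *\<^sub>Q inverse w" using w(1) by (simp add: f1_def scaleQ_scaleQ scaleQ_one)
      also have "\<dots> = ?A (g *\<^sub>Q c) + ?A (x *\<^sub>Q d)"
        unfolding cd(3) f1A[OF cd(1)] shift_op_slice[OF T l cd(2)] x[symmetric]
        by (simp add: scaleQ_add_right scaleQ_scaleQ)
      also have "\<dots> = ?A (g *\<^sub>Q c + x *\<^sub>Q d)" by (simp add: shift_op_add[OF T])
      finally show False using f by blast
    qed
    \<comment> \<open>\<open>s\<close> is chosen so that \<open>s + h\<close> is a real multiple of \<open>j\<close>: then \<open>p x\<close> in the slice makes
      \<open>(s + h) p x\<close> orthogonal to the slice, so that \<open>\<phi> x = e\<close> is impossible\<close>
    define h where "h = qinner e g"
    \<comment> \<open>At most one real multiple of j equals \<open>h\<close>, so one of 1 and 2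
      keeps \<open>s\<close> invertible.\<close>
    obtain r :: real where r: "r \<noteq> 0" "of_real r * jq - h \<noteq> 0"
    proof (cases "jq = h")
      case True
      have "of_real 2 * jq - jq \<noteq> 0" unfolding quat_eq_iff by (simp del: of_real_numeral)
      then show ?thesis using that[of 2] True by simp
    next
      case False
      then show ?thesis using that[of 1] by simp
    qed
    define s where "s = of_real r * jq - h"
    have s: "s \<noteq> 0" using r by (simp add: s_def)
    define p where "p x = inverse s * qinner e x" for x
    have sp: "qinner e x = s * p x" for x using s by (simp add: p_def flip: mult.assoc)
    define K where "K x = f1 *\<^sub>Q (inverse s * qinner e x)" for x
    have K: "K \<in> compact_qops" unfolding K_def[abs_def] by (rule rank_one)
    define \<phi> where "\<phi> x = x + g *\<^sub>Q (inverse s * qinner e x)" for x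
    have "\<phi> \<in> bounded_qops" unfolding \<phi>_def[abs_def] by (rule qop_plus[OF qop_id qop_rank_one])
    then have lin: "linear \<phi>" by (intro bounded_linear.linear bounded_qops_linear)
    have N: "p x \<in> slice \<and> ?A (\<phi> x) = 0 \<and> qinner e (\<phi> x) = of_real r * jq * p x"
      if xN: "x \<in> null_space (shift_op l (\<lambda>x. T x + K x))" for x
    proof -
      have x: "?A x + f1 *\<^sub>Q p x = 0"
        using xN shift_plus[of K x] by (simp add: null_space_def K_def p_def)
      obtain c d where cd: "c \<in> slice" "d \<in> slice" "p x = c + jq * d"
        by (rule slice_decomposition)
      \<comment> \<open>With the slice part of \<open>p x\<close> absorbed by \<open>g\<close>, a
        nonzero \<open>d\<close> could be divided out and would put \<open>f1 *\<^sub>Q jq\<close>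
        into the range.\<close>
      have "?A (- x - g *\<^sub>Q c) = f1 *\<^sub>Q jq *\<^sub>Q d"
      proof -
        have "?A (- x - g *\<^sub>Q c) = - ?A x - f1 *\<^sub>Q c"
          using shift_op_add[OF T, of l "- x" "- (g *\<^sub>Q c)"] by (simp add: A_minus f1A[OF cd(1)])
        also have "- ?A x = f1 *\<^sub>Q p x" using x by (metis add.commute minus_unique)
        finally show ?thesis by (simp add: cd(3) scaleQ_add_right scaleQ_scaleQ)
      qed
      then have "?A ((- x - g *\<^sub>Q c) *\<^sub>Q inverse d) = f1 *\<^sub>Q jq *\<^sub>Q d *\<^sub>Q inverse d"
        by (simp add: shift_op_slice[OF T l slice_inverse[OF cd(2)]])
      then have "?A ((- x - g *\<^sub>Q c) *\<^sub>Q inverse d) = f1 *\<^sub>Q jq" if "d \<noteq> 0"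
        using that by (simp add: scaleQ_scaleQ scaleQ_one mult.assoc)
      then have "d = 0" using f1j by metis
      then have slice: "p x \<in> slice" using cd by simp
      have "?A (\<phi> x) = ?A x + ?A (g *\<^sub>Q p x)" by (simp add: \<phi>_def p_def shift_op_add[OF T])
      then have "?A (\<phi> x) = 0" using x f1A[OF slice] by simp
      moreover have "qinner e (\<phi> x) = s * p x + h * p x"
        unfolding sp[symmetric] by (simp add: \<phi>_def p_def h_def qinner_add_right qinner_scaleQ_right)
      then have "qinner e (\<phi> x) = of_real r * jq * p x" by (simp add: s_def flip: distrib_right)
      ultimately show ?thesis using slice by simp
    qed
    have rj: "of_real r * jq \<noteq> 0" using r(1) by (simp add: quat_eq_iff)
    have "dim (null_space (shift_op l (\<lambda>x. T x + K x))) < dim (null_space ?A)"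
    proof (rule dim_less[OF lin _ _ sub[OF compact_qopsD[OF K]] NB B(1) eN])
      show "inj_on \<phi> (null_space (shift_op l (\<lambda>x. T x + K x)))"
        unfolding linear_inj_on_iff_eq_0[OF lin sub[OF compact_qopsD[OF K]]]
      proof (intro ballI impI)
        fix x assume x: "x \<in> null_space (shift_op l (\<lambda>x. T x + K x))" "\<phi> x = 0"
        then have "of_real r * jq * p x = 0" using N[OF x(1)] by simp
        then have "p x = 0" using rj by (metis mult_eq_0_iff)
        then show "x = 0" using x(2) s by (auto simp: \<phi>_def p_def)
      qed
      show "e \<notin> \<phi> ` null_space (shift_op l (\<lambda>x. T x + K x))"
      proof
        assume "e \<in> \<phi> ` null_space (shift_op l (\<lambda>x. T x + K x))"
        then obtain x where x: "x \<in> null_space (shift_op l (\<lambda>x. T x + K x))" "e = \<phi> x" by blast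
        then have "of_real r * jq * p x = 1" "p x \<in> slice" using N[OF x(1)] ee by auto
        then have "r *\<^sub>R (jq * p x) = 1" by (simp add: scaleR_conv_of_real mult.assoc)
        then show False using \<open>p x \<in> slice\<close> by (simp add: quat_eq_iff slice_def)
      qed
    qed (use N in \<open>auto simp: null_space_def\<close>)
    then show thesis using that K by blast
  qed
qed

text \<open>Induction on the real dimension of the null space of the factor. The Weyl property of
  \<open>Q_op l T\<close> survives each perturbation of \<open>T\<close>, so the reduction applies
  until bijectivity is reached, and the compact corrections add up to one.\<close>

lemma Q_op_compact_perturbation_bij_slice:
  assumes "T \<in> bounded_qops" "l \<in> slice" "weyl_op (Q_op l T)"
  shows "\<exists>K\<in>compact_qops. bij (Q_op l (\<lambda>x. T x + K x))"
  using assms(1,3)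
proof (induction "dim (null_space (shift_op l T))" arbitrary: T rule: less_induct)
  case less
  show ?case
  proof (cases "bij (Q_op l T)")
    case True
    then show ?thesis by (intro bexI[of _ "\<lambda>x. 0"]) (simp_all add: compact_qop_zero)
  next
    case False
    then obtain K where K: "K \<in> compact_qops"
      "dim (null_space (shift_op l (\<lambda>x. T x + K x))) < dim (null_space (shift_op l T))"
      using rank_one_reduces_null_space[OF less.prems(1) assms(2) less.prems(2)] by blast
    have "\<exists>L\<in>compact_qops. bij (Q_op l (\<lambda>x. (T x + K x) + L x))"
      by (rule less.hyps[OF K(2)])
         (use less.prems K(1) in \<open>simp_all add: qop_plus compact_qopsD weyl_op_Q_op_plus_compact\<close>)
    then obtain L where "L \<in> compact_qops" "bij (Q_op l (\<lambda>x. T x + (K x + L x)))"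
      by (auto simp: add.assoc)
    then show ?thesis
      using compact_qop_plus[OF K(1)] by (intro bexI[of _ "\<lambda>x. K x + L x"])
  qed
qed

lemma Q_op_compact_perturbation_bij:
  assumes "T \<in> bounded_qops" "weyl_op (Q_op q T)"
  shows "\<exists>K\<in>compact_qops. bij (Q_op q (\<lambda>x. T x + K x))"
proof -
  \<comment> \<open>The length of the imaginary part of \<open>q\<close> becomes the i-coordinate;
    \<open>Q_op\<close> sees only \<open>qRe q\<close> and \<open>norm q\<close>.\<close>
  define l where "l = Quat (qRe q) (sqrt ((qI q)\<^sup>2 + (qJ q)\<^sup>2 + (qK q)\<^sup>2)) 0 0"
  have "qRe l = qRe q" "norm l = norm q" "l \<in> slice"
    by (simp_all add: l_def norm_quat_def slice_def add.assoc)
  moreover from this have "Q_op q T = Q_op l T" for T :: "'a \<Rightarrow> 'a" by (simp add: Q_op_def)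
  ultimately show ?thesis
    using Q_op_compact_perturbation_bij_slice[of T l] assms by simp
qed

section \<open>The spectra\<close>

text \<open>A point escapes the intersection when a single \<open>K\<close> makes the quadratic
  operator bijective. Expanding the square then shows that \<open>Q_op q T\<close> differs from a
  bijection by a compact operator; the converse is the content of the preceding reduction.\<close>

lemma weyl_S_spectrum_iff:
  assumes T: "T \<in> bounded_qops"
  shows "q \<in> weyl_S_spectrum T \<longleftrightarrow> \<not> weyl_op (Q_op q T)"
proof -
  have "(\<exists>K\<in>compact_qops. bij (Q_op q (\<lambda>x. T x + K x))) \<longleftrightarrow> weyl_op (Q_op q T)"
  proof
    assume "\<exists>K\<in>compact_qops. bij (Q_op q (\<lambda>x. T x + K x))"
    then obtain K where K: "K \<in> compact_qops" "bij (Q_op q (\<lambda>x. T x + K x))" by blast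
    obtain L where L: "L \<in> compact_qops" "\<And>x. Q_op q (\<lambda>x. T x + K x) x = Q_op q T x + L x"
      using Q_op_plus_compact[OF T K(1)] by metis
    have "weyl_op (Q_op q (\<lambda>x. T x + K x))"
      by (rule weyl_op_bij[OF Q_op_in_bounded_qops[OF qop_plus[OF T compact_qopsD[OF K(1)]]] K(2)])
    from weyl_op_plus_compact[OF this compact_qop_uminus[OF L(1)]]
    show "weyl_op (Q_op q T)" by (simp add: L(2))
  qed (rule Q_op_compact_perturbation_bij[OF T])
  then show ?thesis
    using T by (auto simp: weyl_S_spectrum_def S_spectrum_def Units_qop_ring Q_op_in_bounded_qops
        qop_plus compact_qopsD)
qed

lemma fredholm_iff_ess_inverse:
  assumes "A \<in> bounded_qops"
  shows "A \<in> fredholm \<longleftrightarrow> (\<exists>S. ess_inverse A S)"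
  using fredholm_ess_inverse[of A] ess_inverse_fredholm[OF assms] by blast

text \<open>Atkinson's characterization, applied pointwise to \<open>Q_op q T\<close>.\<close>

lemma ess_S_spectrum_eq:
  assumes T: "T \<in> bounded_qops"
  shows "ess_S_spectrum T = - fredholm_domain T"
  using Units_calkin_iff[OF Q_op_in_bounded_qops[OF T]]
    fredholm_iff_ess_inverse[OF Q_op_in_bounded_qops[OF T]]
  by (auto simp: ess_S_spectrum_def fredholm_domain_def)

lemma weyl_op_fredholm:
  assumes "weyl_op A" shows "A \<in> fredholm"
proof -
  obtain C K where C: "C \<in> bounded_qops" "bij C" and K: "K \<in> compact_qops" and A: "A = (\<lambda>x. C x + K x)"
    using assms by (auto simp: weyl_op_def)
  let ?I = "inv_into UNIV C"
  have I: "?I \<in> bounded_qops" by (rule qop_inverse[OF C])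
  have "A (?I x) - x = K (?I x)" "?I (A x) - x = ?I (K x)" for x
    using C(2) by (simp_all add: A qop_add[OF I] bij_is_inj bij_is_surj surj_f_inv_f)
  then have "ess_inverse A ?I"
    using compact_qop_comp_left[OF K I] compact_qop_comp_right[OF K I] I by (simp add: ess_inverse_def)
  then show ?thesis using ess_inverse_fredholm weyl_op_bounded[OF assms] by blast
qed

section \<open>Topology of the set of Weyl points\<close>

lemma Q_op_continuous:
  assumes T: "T \<in> bounded_qops" and e: "e > 0"
  obtains d where "d > 0" "\<And>p x. dist p q < d \<Longrightarrow> norm (Q_op p T x - Q_op q T x) \<le> e * norm x"
proof -
  obtain t where t: "t > 0" "\<And>x. norm (T x) \<le> t * norm x" using qop_bound[OF T] by blast
  \<comment> \<open>A majorant for the operator norm of \<open>Q_op p T - Q_op q T\<close>,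
    continuous in \<open>p\<close> and equal to 0 at \<open>q\<close>.\<close>
  define f where "f p = 2 * norm (p - q) * t + \<bar>(norm p)\<^sup>2 - (norm q)\<^sup>2\<bar>" for p
  have "isCont f q" unfolding f_def by (intro continuous_intros)
  then obtain d where d: "d > 0" "\<And>p. dist p q < d \<Longrightarrow> dist (f p) (f q) < e"
    using e unfolding continuous_at_eps_delta by blast
  have "norm (Q_op p T x - Q_op q T x) \<le> e * norm x" if p: "dist p q < d" for p x
  proof -
    have "Q_op p T x - Q_op q T x = (2 * qRe (q - p)) *\<^sub>R T x + ((norm p)\<^sup>2 - (norm q)\<^sup>2) *\<^sub>R x"
      by (simp add: Q_op_def algebra_simps)
    also have "norm \<dots> \<le> 2 * \<bar>qRe (q - p)\<bar> * norm (T x) + \<bar>(norm p)\<^sup>2 - (norm q)\<^sup>2\<bar> * norm x"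
      by (rule order_trans[OF norm_triangle_ineq]) (simp only: norm_scaleR abs_mult abs_numeral order_refl)
    also have "2 * \<bar>qRe (q - p)\<bar> * norm (T x) \<le> 2 * norm (p - q) * (t * norm x)"
      using qRe_le_norm[of "q - p"] t(2)[of x] by (intro mult_mono) (auto simp: norm_minus_commute)
    finally have "norm (Q_op p T x - Q_op q T x) \<le> f p * norm x"
      by (simp add: f_def distrib_right mult.assoc)
    also have "f p \<le> e" using d(2)[OF p] by (simp add: f_def dist_real_def)
    finally show ?thesis by (simp add: mult_right_mono)
  qed
  then show thesis using that d(1) by blast
qed

lemma open_weyl_set:
  assumes T: "T \<in> bounded_qops"
  shows "open {q. weyl_op (Q_op q T)}"
  unfolding open_dist
proof (intro ballI)
  fix q assume "q \<in> {q. weyl_op (Q_op q T)}"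
  then have "weyl_op (Q_op q T)" by simp
  then obtain e where e: "e > 0"
    "\<And>B. B \<in> bounded_qops \<Longrightarrow> (\<And>x. norm (B x - Q_op q T x) \<le> e * norm x) \<Longrightarrow> weyl_op B"
    using weyl_op_perturbation by blast
  obtain d where "d > 0" "\<And>p x. dist p q < d \<Longrightarrow> norm (Q_op p T x - Q_op q T x) \<le> e * norm x"
    using Q_op_continuous[OF T e(1)] by blast
  then show "\<exists>d>0. \<forall>p. dist p q < d \<longrightarrow> p \<in> {q. weyl_op (Q_op q T)}"
    using e(2) Q_op_in_bounded_qops[OF T] by (intro exI[of _ d]) simp
qed

lemma closure_weyl_set_approx:
  assumes T: "T \<in> bounded_qops" and q: "q \<in> closure {q. weyl_op (Q_op q T)}" and e: "e > 0"
  shows "\<exists>B. weyl_op B \<and> (\<forall>x. norm (B x - Q_op q T x) \<le> e * norm x)"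
proof -
  obtain d where d: "d > 0" "\<And>p x. dist p q < d \<Longrightarrow> norm (Q_op p T x - Q_op q T x) \<le> e * norm x"
    using Q_op_continuous[OF T e] by blast
  then obtain p where "weyl_op (Q_op p T)" "dist p q < d"
    using q unfolding closure_approachable by blast
  then show ?thesis using d(2) by blast
qed

lemma weyl_set_nonempty:
  assumes T: "T \<in> bounded_qops"
  shows "\<exists>q. weyl_op (Q_op q T)"
proof -
  obtain t where t: "t > 0" "\<And>x. norm (T x) \<le> t * norm x" using qop_bound[OF T] by blast
  \<comment> \<open>At a real point \<open>r\<close>, the term \<open>r\<^sup>2\<close> must
    dominate \<open>t * t + 2 * r * t\<close>; this holds for \<open>r\<close> above (1 + sqrt 2) t,
    and \<open>3 * t + 1\<close> is a convenient such value.\<close>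
  define r where "r = 3 * t + 1"
  have r: "r > 0" using t(1) by (simp add: r_def)
  have E: "(\<lambda>x. T (T x) - (2 * r) *\<^sub>R T x) \<in> bounded_qops"
    by (rule qop_sub[OF qop_comp[OF T T] qop_scaled[OF T]])
  have C: "(\<lambda>x. r\<^sup>2 *\<^sub>R x) \<in> bounded_qops" by (rule qop_scaled[OF qop_id])
  have "bij (\<lambda>x::'a. r\<^sup>2 *\<^sub>R x)"
    using r by (intro o_bij[where g = "\<lambda>x. x /\<^sub>R r\<^sup>2"]) (auto simp: fun_eq_iff)
  then have "bij (\<lambda>x. r\<^sup>2 *\<^sub>R x + (T (T x) - (2 * r) *\<^sub>R T x))"
  proof (rule bij_perturbation[OF C _ _ E, where c = "1 / r\<^sup>2" and d = "t * t + 2 * r * t"])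
    show "norm (T (T x) - (2 * r) *\<^sub>R T x) \<le> (t * t + 2 * r * t) * norm x" for x
    proof -
      have "norm (T (T x) - (2 * r) *\<^sub>R T x) \<le> norm (T (T x)) + 2 * r * norm (T x)"
        using norm_triangle_ineq4[of "T (T x)" "(2 * r) *\<^sub>R T x"] r by simp
      moreover have "norm (T (T x)) \<le> t * (t * norm x)"
        using t(2)[of "T x"] mult_left_mono[OF t(2)[of x], of t] t(1) by linarith
      moreover have "2 * r * norm (T x) \<le> 2 * r * (t * norm x)"
        using t(2)[of x] r by (intro mult_left_mono) auto
      ultimately show ?thesis by (simp add: algebra_simps)
    qed
    have "t * t + 2 * r * t < r\<^sup>2"
      using t(1) by (simp add: r_def power2_eq_square algebra_simps add_pos_pos)
    then show "1 / r\<^sup>2 * (t * t + 2 * r * t) < 1" using r by (simp add: divide_less_eq)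
  qed (use t(1) r in \<open>auto simp: field_simps\<close>)
  moreover have "(\<lambda>x. r\<^sup>2 *\<^sub>R x + (T (T x) - (2 * r) *\<^sub>R T x)) = Q_op (of_real r) T"
    by (simp add: fun_eq_iff Q_op_def)
  ultimately have "weyl_op (Q_op (of_real r) T)"
    using weyl_op_bij[OF Q_op_in_bounded_qops[OF T]] by metis
  then show ?thesis ..
qed

theorem theorem4p5:
  fixes T :: "'v::rquat_hilbert \<Rightarrow> 'v"
  assumes separable: "separable_space (euclidean :: 'v topology)"
    and infinite_dim: "qdim (UNIV :: 'v set) = \<infinity>"
    and T: "T \<in> bounded_qops"
  shows "frontier (weyl_S_spectrum T) \<subseteq> weyl1_S_spectrum T \<and>
    (connected (fredholm_domain T) \<longrightarrow>
       frontier (ess_S_spectrum T) = frontier (weyl_S_spectrum T) \<and>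
       frontier (weyl_S_spectrum T) \<subseteq> {q. Q_op q T \<notin> left_fredholm})"
proof -
  define W where "W = {q. weyl_op (Q_op q T)}"
  have openW: "open W" unfolding W_def by (rule open_weyl_set[OF T])
  have spec: "weyl_S_spectrum T = - W" by (auto simp: W_def weyl_S_spectrum_iff[OF T])
  have front: "frontier (weyl_S_spectrum T) = closure W - W"
    unfolding spec frontier_complement by (simp add: frontier_def interior_open openW)
  have approx: "\<exists>B. weyl_op B \<and> (\<forall>x. norm (B x - Q_op q T x) \<le> e * norm x)"
    if "q \<in> closure W" "e > 0" for q and e :: real
    using closure_weyl_set_approx[OF T] that unfolding W_def by blast
  have limit: "q \<in> W" if "q \<in> closure W" "Q_op q T \<in> left_fredholm" "fredholm_index (Q_op q T) \<le> 0" for q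
    using weyl_op_limit[OF that(2,3) approx[OF that(1)]] by (simp add: W_def)
  have part1: "frontier (weyl_S_spectrum T) \<subseteq> weyl1_S_spectrum T"
    unfolding front weyl1_S_spectrum_def using limit by blast
  have "frontier (ess_S_spectrum T) = frontier (weyl_S_spectrum T) \<and>
      frontier (weyl_S_spectrum T) \<subseteq> {q. Q_op q T \<notin> left_fredholm}"
    if conn: "connected (fredholm_domain T)"
  proof -
    have sub: "W \<subseteq> fredholm_domain T"
      by (auto simp: W_def fredholm_domain_def weyl_op_fredholm)
    have closedW: "q \<in> W" if q: "q \<in> fredholm_domain T" "q \<in> closure W" for q
    proof -
      obtain S where "ess_inverse (Q_op q T) S"
        using q(1) fredholm_ess_inverse by (auto simp: fredholm_domain_def)
      from weyl_op_closed_in_ess_invertible[OF Q_op_in_bounded_qops[OF T] this approx[OF q(2)]]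
      show ?thesis by (simp add: W_def)
    qed
    \<comment> \<open>\<open>W\<close> is relatively closed in the domain, so \<open>W\<close> and
      the complement of its closure are disjoint open sets covering it.\<close>
    have "W \<inter> fredholm_domain T = {} \<or> (- closure W) \<inter> fredholm_domain T = {}"
      using closedW closure_subset[of W]
      by (intro connectedD[OF conn openW]) auto
    moreover have "W \<noteq> {}" using weyl_set_nonempty[OF T] by (auto simp: W_def)
    ultimately have eq: "fredholm_domain T = W" using sub closedW by blast
    have "Q_op q T \<notin> left_fredholm" if q: "q \<in> closure W - W" for q
    proof
      assume lf: "Q_op q T \<in> left_fredholm"
      then have "\<not> fredholm_index (Q_op q T) \<le> 0" using limit q by blast
      \<comment> \<open>Infinite codimension with a finite-dimensional null space would make the
        index \<open>-\<infinity>\<close>, contrary to its being positive.\<close>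
      then have "qdim_quot UNIV (range (Q_op q T)) < \<infinity>"
        using lf unfolding fredholm_index_def left_fredholm_def
        by (cases "qdim_quot UNIV (range (Q_op q T))"; cases "qdim (null_space (Q_op q T))") auto
      then have "q \<in> fredholm_domain T"
        using lf by (simp add: fredholm_domain_def fredholm_def left_fredholm_def)
      then show False using eq q by blast
    qed
    then show ?thesis
      using front by (auto simp: ess_S_spectrum_eq[OF T] eq spec)
  qed
  with part1 show ?thesis by blast
qed

end
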